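(* Let the complex variables $w$ and $z$ belong to compact domains. Then for large values of $|x|$, $|\arg x|<\frac14\pi$, we have the representation $$K_{z,w}(2x)=\frac14\sqrt{\frac{\pi}{x}}\,e^{-2x}\left(\cos(2w\sqrt{x})\,P-\sin(2w\sqrt{x})\,Q+e^{-\frac14w^2}R\right),$$ where $P$, $Q$, $R$ (functions of $x,z,w$) have the asymptotic expansions $$P=1+\frac{32z^2-3w^2-8}{128x}+O\left(x^{-2}\right),\qquad Q=\frac{w}{8\sqrt{x}}+O\left(x^{-\frac32}\right),\qquad R=1+\frac{(4z^2-1)(2-w^2)}{32x}+O\left(x^{-2}\right)$$ as $|x|\to\infty$ in $|\arg x|<\frac14\pi$.
   Context: The generalized modified Bessel function is defined, for $z,w\in\mathbb{C}$, by $$K_{z,w}(x):=\frac{1}{2\pi i}\int_{c-i\infty}^{c+i\infty}\Gamma\left(\tfrac{s-z}{2}\right)\Gamma\left(\tfrac{s+z}{2}\right)\,{}_1F_1\left(\tfrac{s-z}{2};\tfrac12;-\tfrac{w^2}{4}\right){}_1F_1\left(\tfrac{s+z}{2};\tfrac12;-\tfrac{w^2}{4}\right)2^{s-2}x^{-s}\,ds,$$ where $c=\mathrm{Re}(s)>|\mathrm{Re}(z)|$ and powers of $x$ and square roots are principal. Here ${}_1F_1(a;c;u)=\sum_{n\ge0}\frac{(a)_n u^n}{(c)_n n!}$ with $(a)_n=a(a+1)\cdots(a+n-1)$. The $O$-constants may depend on the compact sets to which $z$ and $w$ belong, but not on the individual $z,w$ in them. *)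

theory Defs
  imports "HOL-Analysis.Analysis"
begin

definition hyp1F1 :: "complex \<Rightarrow> complex \<Rightarrow> complex \<Rightarrow> complex" where
  "hyp1F1 a c u = (\<Sum>n. pochhammer a n * u ^ n / (pochhammer c n * fact n))"

definition gen_bessel_integrand :: "complex \<Rightarrow> complex \<Rightarrow> complex \<Rightarrow> complex \<Rightarrow> complex" where
  "gen_bessel_integrand z w x s =
     Gamma ((s - z) / 2) * Gamma ((s + z) / 2)
     * hyp1F1 ((s - z) / 2) (1 / 2) (- (w ^ 2) / 4)
     * hyp1F1 ((s + z) / 2) (1 / 2) (- (w ^ 2) / 4)
     * 2 powr (s - 2) * x powr (- s)"

text \<open>
  The generalized modified Bessel function \<open>K\<^sub>z\<^sub>,\<^sub>w(x)\<close>, as a Mellin-Barnes integral along the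
  upward vertical line \<open>Re s = c\<close>, parametrised by \<open>s = c + i t\<close>, so \<open>ds = i dt\<close>. The abscissa
  \<open>c\<close> is kept as an explicit argument. The function is meant for \<open>c > \<bar>Re z\<bar>\<close>, and
  statements about \<open>K\<^sub>z\<^sub>,\<^sub>w\<close> are to be made for every such \<open>c\<close>.
\<close>
definition gen_bessel_K :: "real \<Rightarrow> complex \<Rightarrow> complex \<Rightarrow> complex \<Rightarrow> complex" where
  "gen_bessel_K c z w x =
     1 / (2 * of_real pi * \<i>)
     * (LINT t|lborel. gen_bessel_integrand z w x (Complex c t) * \<i>)"

end

theory Submission
  imports Defs
begin

text \<open>
The kernel of the Mellin-Barnes integral is a product of two Mellin transforms. With
\<open>\<phi>(t) = exp (- y t\<^sup>2) cos (w (sqrt y) t)\<close>, integrating the cosine series term by term gives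
\<open>2 \<integral> \<phi>(t) t\<^sup>2\<^sup>a dt/t = \<Gamma>(a) \<^sub>1F\<^sub>1(a; 1/2; -w\<^sup>2/4) y\<^sup>-\<^sup>a\<close> (\<open>Mellin_damped_cosine\<close>), for complex \<open>y\<close> in
the right half-plane. Taking \<open>y = x\<close> lets the two transforms absorb the whole power \<open>x\<^sup>-\<^sup>s\<close>, so the
contour integral is a Parseval integral, and
\<open>K\<^sub>z\<^sub>,\<^sub>w(2x) = \<integral> exp (-2zv) \<phi>(e\<^sup>v) \<phi>(e\<^sup>-\<^sup>v) dv\<close> (\<open>gen_bessel_K_eq_integral\<close>) holds directly for complex
\<open>x\<close>, without analytic continuation from the positive axis. Parseval needs one of the transforms to
be integrable along the vertical line. It even decays exponentially: turning \<open>y\<close> by \<open>\<plusminus>\<pi>/4\<close> multiplies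
the transform at height \<open>t\<close> by a factor \<open>exp (\<plusminus>\<pi>t/8)\<close> up to a constant, whereas the turned transform
remains bounded as long as its parameter stays in the right half-plane; here \<open>|arg x| < \<pi>/4\<close> is used.

The product-to-sum formula for the two cosines and the substitution \<open>r = sinh v\<close> turn this into
\<open>K\<^sub>z\<^sub>,\<^sub>w(2x) = exp (-2x)/2 \<integral> exp (-4xr\<^sup>2) h(r) (cos (u sqrt (1 + r\<^sup>2)) + cos (ur)) dr\<close> with
\<open>u = 2w sqrt x\<close> and \<open>h(r) = cosh (2z arsinh r) / sqrt (1 + r\<^sup>2)\<close>
(\<open>gen_bessel_K_eq_Laplace_integral\<close>). Splitting \<open>sqrt (1 + r\<^sup>2) = 1 + \<delta>(r)\<close> by the addition theorem
produces exactly the terms \<open>cos u \<cdot> P - sin u \<cdot> Q + e\<^bsup>-w\<^sup>2/4\<^esup> R\<close>, where \<open>P\<close>, \<open>Q\<close> and \<open>e\<^bsup>-w\<^sup>2/4\<^esup> R\<close> are the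
Gaussian means of \<open>h cos (u\<delta>)\<close>, \<open>h sin (u\<delta>)\<close> and \<open>h cos (ur)\<close>.

The expansions are then Laplace's method. Measured in the Gaussian scale \<open>q = |x|\<^sup>1\<^sup>/\<^sup>2 |r|\<close>, the
integrands agree with the models \<open>1 + (2z\<^sup>2 - 1/2) r\<^sup>2 - w\<^sup>2xr\<^sup>4/2\<close>, \<open>w (sqrt x) r\<^sup>2\<close> and
\<open>(1 + (2z\<^sup>2 - 1/2) r\<^sup>2) cos (ur)\<close> up to the stated power of \<open>|x|\<close> times \<open>exp (D q)\<close>, where \<open>D\<close> depends only
on a bound for \<open>|z|\<close> and \<open>|w|\<close>. The Gaussian weight integrates \<open>exp (D q)\<close> to a constant
(\<open>Gauss_mean_bound\<close>), and the Gaussian means of the models are the leading terms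
(\<open>Gauss_mean_values\<close>).
\<close>

section \<open>Integrals in logarithmic variables and the Gamma integral\<close>

lemma absolutely_integrable_on_iff_lborel:
  fixes f :: "real \<Rightarrow> complex"
  assumes "(\<lambda>x. indicator S x *\<^sub>R f x) \<in> borel_measurable borel"
  shows "f absolutely_integrable_on S \<and> integral S f = b \<longleftrightarrow>
         has_bochner_integral lborel (\<lambda>x. indicator S x *\<^sub>R f x) b"
proof -
  have iff: "f absolutely_integrable_on S \<longleftrightarrow> integrable lborel (\<lambda>x. indicator S x *\<^sub>R f x)"
    unfolding set_integrable_def by (rule integrable_completion) (use assms in simp)
  have "integral S f = (\<integral>x. indicator S x *\<^sub>R f x \<partial>lborel)" if "f absolutely_integrable_on S"
  proof -
    have "integral S f = (LINT x:S|lebesgue. f x)"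
      by (rule set_lebesgue_integral_eq_integral(2)[OF that, symmetric])
    also have "\<dots> = (\<integral>x. indicator S x *\<^sub>R f x \<partial>lborel)"
      unfolding set_lebesgue_integral_def by (rule integral_completion) (use assms in simp)
    finally show ?thesis .
  qed
  with iff show ?thesis unfolding has_bochner_integral_iff by metis
qed

text \<open>
Change of variables on the whole real line. It serves both for \<open>exp\<close>, whose range is the positive
half-line, and for \<open>sinh\<close>, whose range is everything; hence the indicator of the range.
\<close>

lemma has_bochner_integral_substitution:
  fixes f :: "real \<Rightarrow> complex" and g h :: "real \<Rightarrow> real"
  assumes deriv: "\<And>x. (g has_field_derivative h x) (at x)"
    and pos: "\<And>x. h x > 0"
    and conts: "continuous_on UNIV h" "continuous_on (range g) f"
    and range: "range g \<in> sets borel"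
  shows "has_bochner_integral lborel (\<lambda>x. h x *\<^sub>R f (g x)) b \<longleftrightarrow>
         has_bochner_integral lborel (\<lambda>x. indicator (range g) x *\<^sub>R f x) b"
proof -
  have strict: "g x < g y" if "x < y" for x y
    by (rule DERIV_pos_imp_increasing[OF that]) (use deriv pos in blast)
  have inj: "inj_on g UNIV"
    by (rule strict_mono_on_imp_inj_on) (auto simp: strict_mono_on_def strict)
  have contg: "continuous_on UNIV g"
    by (intro continuous_at_imp_continuous_on ballI DERIV_isCont[OF deriv])
  have m1: "(\<lambda>x. h x *\<^sub>R f (g x)) \<in> borel_measurable lborel"
  proof -
    have "continuous_on UNIV (\<lambda>x. h x *\<^sub>R f (g x))"
      by (intro continuous_on_scaleR conts continuous_on_compose2[OF conts(2) contg]) auto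
    then show ?thesis by (simp add: borel_measurable_continuous_onI)
  qed
  have m2: "(\<lambda>x. indicator (range g) x *\<^sub>R f x) \<in> borel_measurable lborel"
    using borel_measurable_continuous_on_indicator[OF range conts(2)] by simp
  have key: "(\<lambda>x. \<bar>h x\<bar> *\<^sub>R f (g x)) absolutely_integrable_on UNIV \<and>
       integral UNIV (\<lambda>x. \<bar>h x\<bar> *\<^sub>R f (g x)) = b
     \<longleftrightarrow> f absolutely_integrable_on range g \<and> integral (range g) f = b"
    by (rule has_absolute_integral_change_of_variables_real)
       (auto intro: inj deriv has_field_derivative_at_within)
  have abs: "\<bar>h x\<bar> = h x" for x using pos[of x] by simp
  have 1: "(\<lambda>x. h x *\<^sub>R f (g x)) absolutely_integrable_on UNIV \<and>
       integral UNIV (\<lambda>x. h x *\<^sub>R f (g x)) = b \<longleftrightarrow>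
      has_bochner_integral lborel (\<lambda>x. h x *\<^sub>R f (g x)) b"
    using absolutely_integrable_on_iff_lborel[of UNIV "\<lambda>x. h x *\<^sub>R f (g x)" b] m1 by simp
  have 2: "f absolutely_integrable_on range g \<and> integral (range g) f = b \<longleftrightarrow>
      has_bochner_integral lborel (\<lambda>x. indicator (range g) x *\<^sub>R f x) b"
    using absolutely_integrable_on_iff_lborel[of "range g" f b] m2 by simp
  show ?thesis using key 1 2 unfolding abs by blast
qed

lemma range_exp_real: "range (exp :: real \<Rightarrow> real) = {0<..}"
proof (intro equalityI subsetI)
  fix t :: real assume "t \<in> {0<..}"
  then have "t = exp (ln t)" by simp
  then show "t \<in> range exp" by blast
qed auto

text \<open>
Euler's integral with \<open>t = e\<^sup>v\<close>. In this variable all integrands live on the whole line and are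
continuous, and Mellin transforms become Fourier transforms.
\<close>

lemma Gamma_integral_exp:
  fixes a :: complex
  assumes "Re a > 0"
  shows "has_bochner_integral lborel (\<lambda>v::real. exp (a * v) * exp (- of_real (exp v))) (Gamma a)"
proof -
  define f :: "real \<Rightarrow> complex" where "f = (\<lambda>t. of_real t powr (a - 1) / of_real (exp t))"
  have "f absolutely_integrable_on {0<..}"
    unfolding f_def by (rule absolutely_integrable_Gamma_integral'[OF assms])
  moreover have "integral {0<..} f = Gamma a"
    unfolding f_def by (rule integral_unique[OF Gamma_integral_complex'[OF assms]])
  moreover have cont: "continuous_on {0<..} f"
    unfolding f_def by (intro continuous_intros) (auto simp: complex_nonpos_Reals_iff)
  moreover have "(\<lambda>x. indicator {0<..} x *\<^sub>R f x) \<in> borel_measurable lborel"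
    using borel_measurable_continuous_on_indicator[OF _ cont] by simp
  ultimately have "has_bochner_integral lborel (\<lambda>x. indicator {0<..} x *\<^sub>R f x) (Gamma a)"
    using absolutely_integrable_on_iff_lborel[of "{0<..}" f "Gamma a"] by simp
  then have "has_bochner_integral lborel (\<lambda>x. exp x *\<^sub>R f (exp x)) (Gamma a)"
    by (subst has_bochner_integral_substitution)
       (auto simp: range_exp_real cont intro!: continuous_intros derivative_eq_intros)
  moreover have "exp x *\<^sub>R f (exp x) = exp (a * x) * exp (- of_real (exp x))" for x :: real
    by (simp add: f_def powr_def scaleR_conv_of_real exp_minus divide_simps exp_of_real 
          ring_distribs exp_add exp_diff Ln_of_real)
  ultimately show ?thesis by simp
qed

lemma Gamma_integral_exp_real_scale:
  fixes a :: complex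
  assumes "Re a > 0" "\<alpha> > 0"
  shows "has_bochner_integral lborel (\<lambda>v::real. exp (a * v) * exp (- of_real (\<alpha> * exp v)))
           (Gamma a * exp (- a * of_real (ln \<alpha>)))"
proof -
  have "has_bochner_integral lborel
         (\<lambda>v. exp (a * of_real (ln \<alpha> + 1 * v)) * exp (- of_real (exp (ln \<alpha> + 1 * v)))) (Gamma a /\<^sub>R \<bar>1\<bar>)"
    by (subst lborel_has_bochner_integral_real_affine_iff[symmetric]) (use Gamma_integral_exp[OF assms(1)] in simp_all)
  then have "has_bochner_integral lborel
         (\<lambda>v. exp (- a * of_real (ln \<alpha>)) * (exp (a * of_real (ln \<alpha> + 1 * v)) * exp (- of_real (exp (ln \<alpha> + 1 * v)))))
         (exp (- a * of_real (ln \<alpha>)) * (Gamma a /\<^sub>R \<bar>1\<bar>))"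
    by (rule has_bochner_integral_mult_right)
  moreover have "exp (- a * of_real (ln \<alpha>)) * (exp (a * of_real (ln \<alpha> + 1 * v)) * exp (- of_real (exp (ln \<alpha> + 1 * v))))
     = exp (a * v) * exp (- of_real (\<alpha> * exp v))" for v :: real
    using assms(2) by (simp add: exp_add ring_distribs exp_minus)
  ultimately show ?thesis by (simp add: mult.commute)
qed

lemma Gamma_plus_of_nat:
  fixes a :: complex
  assumes "Re a > 0"
  shows "Gamma (a + of_nat n) = pochhammer a n * Gamma a"
proof -
  have "a \<notin> \<int>\<^sub>\<le>\<^sub>0" using assms by (auto elim!: nonpos_Ints_cases)
  then show ?thesis by (subst pochhammer_Gamma) (auto simp: Gamma_eq_zero_iff)
qed

lemma sums_pochhammer_geometric:
  assumes "norm (z::complex) < 1"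
  shows "(\<lambda>n. pochhammer a n / fact n * z ^ n) sums (1 - z) powr (- a)"
proof -
  have "((- a) gchoose n) * (- z) ^ n = pochhammer a n / fact n * z ^ n" for n
    unfolding gbinomial_pochhammer power_minus[of z] by simp
  then show ?thesis
    using gen_binomial_complex[of "-z" "-a"] assms by simp
qed

text \<open>
Usually obtained by rotating the contour. Here \<open>exp (- c t)\<close> is expanded around \<open>exp (- \<alpha> t)\<close> with a
large real \<open>\<alpha>\<close>, and the resulting series is the binomial series of \<open>(c / \<alpha>) powr (- a)\<close>.
\<close>

lemma Gamma_integral_exp_scale:
  fixes a c :: complex
  assumes a: "Re a > 0" and c: "Re c > 0"
  shows "has_bochner_integral lborel (\<lambda>v::real. exp (a * v) * exp (- c * of_real (exp v)))
           (Gamma a * c powr (- a))"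
proof -
  \<comment> \<open>Every point of the right half-plane lies in a disc \<open>|c - \<alpha>| < \<alpha>\<close>; this \<open>\<alpha>\<close> is large enough.\<close>
  define \<alpha> where "\<alpha> = (norm c)\<^sup>2 / Re c"
  define q where "q = (of_real \<alpha> - c) / of_real \<alpha>"
  have c0: "c \<noteq> 0" using c by auto
  have \<alpha>: "\<alpha> > 0" using c c0 by (simp add: \<alpha>_def)
  have "(norm (of_real \<alpha> - c))\<^sup>2 = \<alpha>\<^sup>2 - 2 * \<alpha> * Re c + (norm c)\<^sup>2"
    unfolding cmod_power2 by (simp add: power2_eq_square algebra_simps)
  also have "\<dots> < \<alpha>\<^sup>2" using c c0 by (simp add: \<alpha>_def)
  finally have "norm (of_real \<alpha> - c) < \<alpha>"
    using \<alpha> by (meson less_eq_real_def power2_less_imp_less)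
  then have q: "norm q < 1" using \<alpha> by (simp add: q_def norm_divide)
  define f where "f n v = (of_real \<alpha> - c) ^ n / fact n *
     (exp ((a + of_nat n) * of_real v) * exp (- of_real (\<alpha> * exp v)))" for n and v :: real
  have exp_shift: "exp (-(a + of_nat n) * of_real (ln \<alpha>)) = exp (-a * of_real (ln \<alpha>)) / of_real \<alpha> ^ n" for n and a :: complex
    using \<alpha> by (simp add: ring_distribs exp_add exp_diff exp_minus exp_of_nat_mult divide_simps exp_of_real)
  have fi: "has_bochner_integral lborel (f n)
      (Gamma a * exp (-a * of_real (ln \<alpha>)) * (pochhammer a n / fact n * q ^ n))" for n
  proof -
    have *: "Re (a + of_nat n) > 0" using a by simp
    have "has_bochner_integral lborel (f n) ((of_real \<alpha> - c) ^ n / fact n *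
        (Gamma (a + of_nat n) * exp (-(a + of_nat n) * of_real (ln \<alpha>))))"
      unfolding f_def
      by (rule has_bochner_integral_mult_right[OF Gamma_integral_exp_real_scale[OF * \<alpha>]])
    then show ?thesis unfolding exp_shift q_def
      by (simp add: Gamma_plus_of_nat[OF a] power_divide mult_ac)
  qed
  have nf0: "norm (f n v) = norm (of_real \<alpha> - c) ^ n / fact n *
     (exp ((Re a + of_nat n) * v) * exp (- (\<alpha> * exp v)))" for n v
    by (simp add: f_def norm_mult norm_divide norm_power)
  have nf: "complex_of_real (norm (f n v)) = of_real (norm (of_real \<alpha> - c) ^ n / fact n) *
     (exp ((of_real (Re a) + of_nat n) * of_real v) * exp (- of_real (\<alpha> * exp v)))" for n v
    unfolding nf0 by (simp add: of_real_exp del: exp_of_real)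
  have nq: "norm q = norm (of_real \<alpha> - c) / \<alpha>"
    using \<alpha> by (simp add: q_def norm_divide)
  have nfi: "(\<integral>v. norm (f n v) \<partial>lborel) =
      Re (Gamma (of_real (Re a)) * exp (-of_real (Re a) * of_real (ln \<alpha>))
         * (pochhammer (of_real (Re a)) n / fact n * of_real (norm q) ^ n))" for n
  proof -
    have *: "Re (complex_of_real (Re a) + of_nat n) > 0" using a by simp
    have pG: "Gamma (complex_of_real (Re a) + of_nat n) = pochhammer (of_real (Re a)) n * Gamma (of_real (Re a))"
      by (rule Gamma_plus_of_nat) (use a in simp)
    have hb: "has_bochner_integral lborel (\<lambda>v. of_real (norm (f n v)))
      (complex_of_real (norm (of_real \<alpha> - c) ^ n / fact n) *
        (Gamma (of_real (Re a) + of_nat n) * exp (-(of_real (Re a) + of_nat n) * of_real (ln \<alpha>))))"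
      unfolding nf by (intro has_bochner_integral_mult_right Gamma_integral_exp_real_scale[OF * \<alpha>])
    have eq: "complex_of_real (norm (of_real \<alpha> - c) ^ n / fact n) *
        (Gamma (of_real (Re a) + of_nat n) * exp (-(of_real (Re a) + of_nat n) * of_real (ln \<alpha>)))
      = Gamma (of_real (Re a)) * exp (-of_real (Re a) * of_real (ln \<alpha>))
         * (pochhammer (of_real (Re a)) n / fact n * of_real (norm q) ^ n)"
    proof -
      have arr: "x / d * (p * g * (e / r)) = g * e * (p / d * (x / r))" for x d p g e r :: complex
        unfolding divide_inverse by (simp only: mult_ac)
      show ?thesis
        unfolding exp_shift nq pG of_real_divide of_real_power power_divide of_real_fact by (rule arr)
    qed
    have "(\<integral>v. complex_of_real (norm (f n v)) \<partial>lborel) = Gamma (of_real (Re a)) * exp (-of_real (Re a) * of_real (ln \<alpha>))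
         * (pochhammer (of_real (Re a)) n / fact n * of_real (norm q) ^ n)"
      using has_bochner_integral_integral_eq[OF hb] unfolding eq .
    from arg_cong[OF this, of Re] show ?thesis unfolding integral_complex_of_real Re_complex_of_real .
  qed
  have es: "exp ((a + of_nat n) * of_real v) = exp (a * of_real v) * exp (of_real v) ^ n" for n v
    by (simp add: distrib_right exp_add exp_of_nat_mult)
  have fsums: "(\<lambda>n. f n v) sums (exp (a * v) * exp (- c * of_real (exp v)))" for v
  proof -
    have "(\<lambda>n. ((of_real \<alpha> - c) * exp (of_real v)) ^ n /\<^sub>R fact n) sums exp ((of_real \<alpha> - c) * exp (of_real v))"
      by (rule exp_converges)
    then have "(\<lambda>n. exp (a * v) * exp (- of_real (\<alpha> * exp v)) * (((of_real \<alpha> - c) * exp (of_real v)) ^ n /\<^sub>R fact n))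
      sums (exp (a * v) * exp (- of_real (\<alpha> * exp v)) * exp ((of_real \<alpha> - c) * exp (of_real v)))"
      by (rule sums_mult)
    moreover have "exp (a * v) * exp (- of_real (\<alpha> * exp v)) * (((of_real \<alpha> - c) * exp (of_real v)) ^ n /\<^sub>R fact n) = f n v" for n
      by (simp add: f_def es scaleR_conv_of_real power_mult_distrib divide_inverse)
    moreover have "exp (- of_real (\<alpha> * exp v)) * exp ((of_real \<alpha> - c) * exp (of_real v)) = exp (- c * of_real (exp v))"
    proof -
      have "- of_real (\<alpha> * exp v) + (of_real \<alpha> - c) * exp (of_real v) = - c * of_real (exp v)"
        by (simp add: exp_of_real left_diff_distrib)
      then show ?thesis by (simp only: mult_exp_exp)
    qed
    ultimately show ?thesis by (simp only: mult.assoc)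
  qed
  have nfsums: "summable (\<lambda>n. norm (f n v))" for v
  proof -
    have "norm (f n v) = exp (Re a * v) * exp (- (\<alpha> * exp v)) * ((norm (of_real \<alpha> - c) * exp v) ^ n /\<^sub>R fact n)" for n
      unfolding f_def es by (simp add: norm_mult norm_divide norm_power norm_inverse power_mult_distrib divide_inverse)
    then show ?thesis by (simp only: summable_mult summable_exp_generic)
  qed
  have sum_nfi: "summable (\<lambda>n. \<integral>v. norm (f n v) \<partial>lborel)"
    unfolding nfi
    by (intro summable_Re summable_mult sums_summable[OF sums_pochhammer_geometric]) (use q in auto)
  have int: "integrable lborel (f n)" for n using fi has_bochner_integral_iff by blast
  have "(\<lambda>n. integral\<^sup>L lborel (f n)) sums (Gamma a * exp (-a * of_real (ln \<alpha>)) * (1 - q) powr (-a))"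
    unfolding has_bochner_integral_integral_eq[OF fi] by (rule sums_mult[OF sums_pochhammer_geometric[OF q]])
  moreover have "(\<lambda>n. integral\<^sup>L lborel (f n)) sums (\<integral>v. (\<Sum>n. f n v) \<partial>lborel)"
    by (rule sums_integral) (use int nfsums sum_nfi in auto)
  ultimately have "(\<integral>v. (\<Sum>n. f n v) \<partial>lborel) = Gamma a * exp (-a * of_real (ln \<alpha>)) * (1 - q) powr (-a)"
    by (rule sums_unique2[symmetric])
  moreover have "integrable lborel (\<lambda>v. \<Sum>n. f n v)"
    by (rule integrable_suminf) (use int nfsums sum_nfi in auto)
  moreover have "exp (-a * of_real (ln \<alpha>)) * (1 - q) powr (-a) = c powr (-a)"
  proof -
    have "1 - q = c / of_real \<alpha>" using \<alpha> by (simp add: q_def field_simps)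
    then have "c = of_real \<alpha> * (1 - q)" using \<alpha> by simp
    moreover have "(of_real \<alpha> * (1 - q)) powr (-a) = of_real \<alpha> powr (-a) * (1-q) powr (-a)"
      using \<alpha> by (intro powr_times_real_left) auto
    ultimately show ?thesis using \<alpha> by (simp add: powr_def Ln_of_real)
  qed
  ultimately show ?thesis
    using sums_unique[OF fsums] by (simp add: has_bochner_integral_iff mult.assoc)
qed

section \<open>The Mellin transform of a damped cosine\<close>

text \<open>
This is \<open>exp (- y t\<^sup>2) cos (w (sqrt y) t)\<close> at \<open>t = e\<^sup>v\<close>. Coupling the frequency to the principal root of
\<open>y\<close> makes the hypergeometric factor of the Mellin transform independent of \<open>y\<close>.
\<close>

definition damped_cosine :: "complex \<Rightarrow> complex \<Rightarrow> real \<Rightarrow> complex" where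
  "damped_cosine y w v = exp (- y * of_real (exp (2 * v))) * cos (w * csqrt y * of_real (exp v))"

lemma Gamma_integral_exp_square:
  fixes a c :: complex
  assumes a: "Re a > 0" and c: "Re c > 0"
  shows "has_bochner_integral lborel (\<lambda>v::real. exp (2 * a * v) * exp (- c * of_real (exp (2 * v))))
           (Gamma a * c powr (- a) / 2)"
proof -
  have "has_bochner_integral lborel
         (\<lambda>v. exp (a * of_real (0 + 2 * v)) * exp (- c * of_real (exp (0 + 2 * v))))
         ((Gamma a * c powr (- a)) /\<^sub>R \<bar>2\<bar>)"
    by (subst lborel_has_bochner_integral_real_affine_iff[symmetric])
       (use Gamma_integral_exp_scale[OF a c] in simp_all)
  then show ?thesis by (simp add: scaleR_conv_of_real field_simps)
qed

lemma powr_minus_plus_nat: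
  fixes y a :: complex
  assumes "y \<noteq> 0"
  shows "y powr (- (a + of_nat n)) = y powr (- a) / y ^ n"
proof -
  have "y powr (- (a + of_nat n)) = y powr (- a - of_nat n)" by simp
  also have "\<dots> = y powr (- a) / y ^ n" using assms by (simp add: powr_diff powr_nat' del: minus_diff_eq)
  finally show ?thesis .
qed

lemma cos_even_sums:
  fixes z :: complex
  shows "(\<lambda>n. (- 1) ^ n * z ^ (2 * n) / fact (2 * n)) sums cos z"
proof -
  have "(\<lambda>n. cos_coeff (2 * n) *\<^sub>R z ^ (2 * n)) sums cos z \<longleftrightarrow> (\<lambda>n. cos_coeff n *\<^sub>R z ^ n) sums cos z"
    by (rule sums_mono_reindex) (auto simp: strict_mono_def cos_coeff_def image_iff elim: evenE)
  then have "(\<lambda>n. cos_coeff (2 * n) *\<^sub>R z ^ (2 * n)) sums cos z"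
    using cos_converges by blast
  moreover have "cos_coeff (2 * n) *\<^sub>R z ^ (2 * n) = (- 1) ^ n * z ^ (2 * n) / fact (2 * n)" for n
    by (simp add: cos_coeff_def scaleR_conv_of_real)
  ultimately show ?thesis by simp
qed

lemma summable_pochhammer_over_fact_double:
  fixes A x :: real
  assumes A: "A > 0" and x: "x \<ge> 0"
  shows "summable (\<lambda>n. pochhammer A n * x ^ n / fact (2 * n))"
proof (rule summable_ratio_test)
  define N where "N = nat \<lceil>2 * x * (A + 1)\<rceil>"
  show "norm (pochhammer A (Suc n) * x ^ Suc n / fact (2 * Suc n))
        \<le> 1/2 * norm (pochhammer A n * x ^ n / fact (2 * n))" if n: "n \<ge> N" for n
  proof -
    have p: "pochhammer A n \<ge> 0" using A by (simp add: less_imp_le pochhammer_pos)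
    have "2 * x * (A + 1) \<le> real N" unfolding N_def by linarith
    with n have le: "2 * x * (A + 1) \<le> real n" by linarith
    moreover have "A + n \<le> (A + 1) * (2 * n + 2)" using A by (simp add: algebra_simps)
    ultimately have "2 * x * (A + n) \<le> 2 * x * ((A + 1) * (2 * n + 2))"
      using x by (intro mult_left_mono) auto
    also have "\<dots> = 2 * x * (A + 1) * (2 * n + 2)" by (simp add: mult.assoc)
    also have "\<dots> \<le> real n * (2 * n + 2)" using le by (intro mult_right_mono) auto
    also have "\<dots> \<le> real (2 * n + 1) * real (2 * n + 2)" by (intro mult_mono) auto
    finally have "2 * (x * (A + n)) \<le> real (2 * n + 1) * real (2 * n + 2)" by (simp add: mult.assoc)
    then have r: "x * (A + n) / (real (2 * n + 1) * real (2 * n + 2)) \<le> 1 / 2"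
      by (simp add: divide_simps)
    have "pochhammer A (Suc n) * x ^ Suc n / fact (2 * Suc n)
       = (x * (A + n) / (real (2 * n + 1) * real (2 * n + 2))) * (pochhammer A n * x ^ n / fact (2 * n))"
      by (simp add: pochhammer_Suc mult_ac)
    also have "\<dots> \<le> 1/2 * (pochhammer A n * x ^ n / fact (2 * n))"
      by (rule mult_right_mono[OF r]) (use p x in auto)
    finally show ?thesis using A x p by (simp add: pochhammer_pos less_imp_le)
  qed
qed simp

text \<open>
The cosine series is integrated term by term; since \<open>(2n)! = 4\<^sup>n (1/2)\<^sub>n n!\<close>, the terms are those of
\<open>\<^sub>1F\<^sub>1\<close>. The interchange is justified by the convergence of the sum of the \<open>L\<^sup>1\<close> norms, which are of
the same shape with all parameters replaced by real ones.
\<close>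

lemma Mellin_damped_cosine:
  fixes a y w :: complex
  assumes a: "Re a > 0" and y: "Re y > 0"
  shows "has_bochner_integral lborel (\<lambda>v::real. exp (2 * a * v) * damped_cosine y w v)
           (Gamma a * hyp1F1 a (1/2) (- (w ^ 2) / 4) * y powr (- a) / 2)"
proof -
  have y0: "y \<noteq> 0" using y by auto
  define k where "k n = (- 1) ^ n * (w ^ 2 * y) ^ n / fact (2 * n)" for n
  define f where "f n v = k n * (exp (2 * (a + of_nat n) * of_real v) * exp (- y * of_real (exp (2 * v))))"
    for n and v :: real
  have fi: "has_bochner_integral lborel (f n)
    (Gamma a * y powr (- a) / 2 * (pochhammer a n * (- (w ^ 2) / 4) ^ n / (pochhammer (1/2) n * fact n)))" for n
  proof -
    have *: "Re (a + of_nat n) > 0" using a by simp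
    have "has_bochner_integral lborel (f n) (k n * (Gamma (a + of_nat n) * y powr (- (a + of_nat n)) / 2))"
      unfolding f_def by (intro has_bochner_integral_mult_right Gamma_integral_exp_square[OF * y])
    moreover have "k n * (Gamma (a + of_nat n) * y powr (- (a + of_nat n)) / 2) =
       Gamma a * y powr (- a) / 2 * (pochhammer a n * (- (w ^ 2) / 4) ^ n / (pochhammer (1/2) n * fact n))"
    proof -
      have fd: "(fact (2 * n) :: complex) = 4 ^ n * pochhammer (1/2) n * fact n"
        by (simp add: fact_double power_mult)
      have "(- (w ^ 2) / 4) ^ n = (- 1) ^ n * (w ^ 2) ^ n / 4 ^ n"
        by (simp only: power_divide power_minus[of "w ^ 2"])
      then show ?thesis
        unfolding k_def fd Gamma_plus_of_nat[OF a] powr_minus_plus_nat[OF y0] power_mult_distrib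
        using y0 by (simp add: divide_simps)
    qed
    ultimately show ?thesis by (simp only:)
  qed
  have int: "integrable lborel (f n)" for n using fi has_bochner_integral_iff by blast
  have esplit: "exp (2 * (b + of_nat n) * of_real v) = exp (2 * b * of_real v) * of_real (exp v) ^ (2 * n)"
    for b :: complex and v :: real and n
  proof -
    have "exp (2 * (b + of_nat n) * of_real v) = exp (2 * b * of_real v) * exp (of_nat (2 * n) * of_real v)"
      by (simp add: exp_add [symmetric] algebra_simps)
    then show ?thesis by (simp only: exp_of_nat_mult exp_of_real)
  qed
  have feq: "f n v = (exp (2 * a * v) * exp (- y * of_real (exp (2 * v)))) *
      ((- 1) ^ n * (w * csqrt y * of_real (exp v)) ^ (2 * n) / fact (2 * n))" for n and v :: real
    unfolding f_def k_def esplit power_mult power_mult_distrib power2_csqrt by (simp add: mult_ac)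
  have fsums: "(\<lambda>n. f n v) sums (exp (2 * a * v) * damped_cosine y w v)" for v
  proof -
    have "exp (2 * a * v) * damped_cosine y w v = (exp (2 * a * v) * exp (- y * of_real (exp (2 * v)))) *
       cos (w * csqrt y * of_real (exp v))"
      by (simp only: damped_cosine_def mult.assoc)
    then show ?thesis unfolding feq by (simp only: sums_mult[OF cos_even_sums])
  qed
  have nfsums: "summable (\<lambda>n. norm (f n v))" for v
  proof -
    define z where "z = w * csqrt y * of_real (exp v)"
    have "summable (\<lambda>n. norm (cos_coeff (2 * n) *\<^sub>R z ^ (2 * n))) \<longleftrightarrow>
          summable (\<lambda>n. norm (cos_coeff n *\<^sub>R z ^ n))"
      by (rule summable_mono_reindex) (auto simp: strict_mono_def cos_coeff_def image_iff elim: evenE)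
    then have "summable (\<lambda>n. norm (cos_coeff (2 * n) *\<^sub>R z ^ (2 * n)))"
      using summable_norm_cos by blast
    moreover have "norm (f n v) = norm (exp (2 * a * v) * exp (- y * of_real (exp (2 * v)))) *
        norm (cos_coeff (2 * n) *\<^sub>R z ^ (2 * n))" for n
      unfolding feq z_def by (simp add: cos_coeff_def norm_mult norm_divide norm_power)
    ultimately show ?thesis by (simp only: summable_mult)
  qed
  define A where "A = Re a"
  have A: "A > 0" using a by (simp add: A_def)
  have nfi: "(\<integral>v. norm (f n v) \<partial>lborel) =
      Re (Gamma (of_real A) * of_real (Re y) powr (- of_real A) / 2)
        * (pochhammer A n * (norm (w ^ 2 * y) / Re y) ^ n / fact (2 * n))" for n
  proof -
    have *: "Re (complex_of_real A + of_nat n) > 0" using A by simp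
    have yr: "Re (complex_of_real (Re y)) > 0" using y by simp
    have nf: "complex_of_real (norm (f n v)) = of_real (norm (k n)) *
       (exp (2 * (of_real A + of_nat n) * of_real v) * exp (- of_real (Re y) * of_real (exp (2 * v))))" for v
    proof -
      have "norm (f n v) = norm (k n) * (exp (2 * (A + real n) * v) * exp (- Re y * exp (2 * v)))"
        by (simp add: f_def norm_mult A_def)
      then show ?thesis by (simp flip: exp_of_real)
    qed
    have "has_bochner_integral lborel (\<lambda>v. complex_of_real (norm (f n v)))
       (of_real (norm (k n)) * (Gamma (of_real A + of_nat n) * of_real (Re y) powr (- (of_real A + of_nat n)) / 2))"
      unfolding nf by (intro has_bochner_integral_mult_right Gamma_integral_exp_square[OF * yr])
    then have "complex_of_real (\<integral>v. norm (f n v) \<partial>lborel) =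
       of_real (norm (k n)) * (Gamma (of_real A + of_nat n) * of_real (Re y) powr (- (of_real A + of_nat n)) / 2)"
      using has_bochner_integral_integral_eq integral_complex_of_real by metis
    also have "\<dots> = (Gamma (of_real A) * of_real (Re y) powr (- of_real A) / 2)
        * of_real (pochhammer A n * (norm (w ^ 2 * y) / Re y) ^ n / fact (2 * n))"
    proof -
      have g: "Gamma (complex_of_real A + of_nat n) = pochhammer (of_real A) n * Gamma (of_real A)"
        by (rule Gamma_plus_of_nat) (use A in simp)
      have p: "complex_of_real (Re y) powr (- (of_real A + of_nat n)) = of_real (Re y) powr (- of_real A) / of_real (Re y) ^ n"
        by (rule powr_minus_plus_nat) (use y in auto)
      have kn: "norm (k n) = norm (w ^ 2 * y) ^ n / fact (2 * n)"
        by (simp add: k_def norm_mult norm_divide norm_power power_mult_distrib)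
      show ?thesis unfolding g p kn
        by (simp add: power_divide pochhammer_of_real mult_ac)
    qed
    finally have "complex_of_real (\<integral>v. norm (f n v) \<partial>lborel) =
      (Gamma (of_real A) * of_real (Re y) powr (- of_real A) / 2)
        * of_real (pochhammer A n * (norm (w ^ 2 * y) / Re y) ^ n / fact (2 * n))" .
    then have "(\<integral>v. norm (f n v) \<partial>lborel) = Re ((Gamma (of_real A) * of_real (Re y) powr (- of_real A) / 2)
        * of_real (pochhammer A n * (norm (w ^ 2 * y) / Re y) ^ n / fact (2 * n)))"
      unfolding complex_eq_iff by (simp only: Re_complex_of_real)
    moreover have "Re (z * complex_of_real r) = Re z * r" for z r by simp
    ultimately show ?thesis by (simp only:)
  qed
  have sum_nfi: "summable (\<lambda>n. \<integral>v. norm (f n v) \<partial>lborel)"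
    unfolding nfi using A y
    by (intro summable_mult summable_pochhammer_over_fact_double) auto
  have "(\<lambda>n. integral\<^sup>L lborel (f n)) sums (\<integral>v. (\<Sum>n. f n v) \<partial>lborel)"
    by (rule sums_integral) (use int nfsums sum_nfi in auto)
  then have sumI: "(\<lambda>n. Gamma a * y powr (- a) / 2 * (pochhammer a n * (- (w ^ 2) / 4) ^ n / (pochhammer (1/2) n * fact n)))
       sums (\<integral>v. (\<Sum>n. f n v) \<partial>lborel)"
    unfolding has_bochner_integral_integral_eq[OF fi] .
  have G0: "Gamma a * y powr (- a) / 2 \<noteq> 0"
    using a y0 by (auto simp: Gamma_eq_zero_iff elim!: nonpos_Ints_cases)
  have "summable (\<lambda>n. pochhammer a n * (- (w ^ 2) / 4) ^ n / (pochhammer (1/2) n * fact n))"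
    using sums_summable[OF sumI] G0 by (simp only: summable_cmult_iff) simp
  then have "(\<integral>v. (\<Sum>n. f n v) \<partial>lborel) = Gamma a * y powr (- a) / 2 * hyp1F1 a (1/2) (- (w ^ 2) / 4)"
    using sums_unique[OF sumI] unfolding hyp1F1_def by (simp only: suminf_mult)
  moreover have "integrable lborel (\<lambda>v. \<Sum>n. f n v)"
    by (rule integrable_suminf) (use int nfsums sum_nfi in auto)
  ultimately show ?thesis
    using sums_unique[OF fsums] by (simp add: has_bochner_integral_iff mult_ac)
qed

section \<open>Gaussian moments\<close>

lemma powr_minus_nat_plus_half:
  assumes "Re y > 0"
  shows "y powr (- (of_nat k + 1/2)) = 1 / (y ^ k * csqrt y)"
proof -
  have "y \<noteq> 0" using assms by auto
  then have "y powr (- (1/2 + of_nat k)) = y powr (- (1/2)) / y ^ k" by (rule powr_minus_plus_nat)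
  also have "y powr (- (1/2)) = 1 / csqrt y"
    unfolding csqrt_conv_powr powr_minus by (rule inverse_eq_divide)
  finally show ?thesis by (simp add: add.commute mult.commute)
qed

text \<open>
The Mellin transform at \<open>a = k + 1/2\<close> is an integral over \<open>r = e\<^sup>v > 0\<close> of an even function of \<open>r\<close>.
\<close>

lemma Gaussian_cos_moment:
  fixes y w :: complex
  assumes y: "Re y > 0"
  shows "has_bochner_integral lborel
     (\<lambda>r::real. exp (- y * of_real r ^ 2) * cos (w * csqrt y * of_real r) * of_real r ^ (2 * k))
     (Gamma (of_nat k + 1/2) * hyp1F1 (of_nat k + 1/2) (1/2) (- (w ^ 2) / 4) / (y ^ k * csqrt y))"
proof -
  define f where "f r = exp (- y * of_real r ^ 2) * cos (w * csqrt y * of_real r) * of_real r ^ (2 * k)" for r :: real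
  define I where "I = Gamma (of_nat k + 1/2) * hyp1F1 (of_nat k + 1/2) (1/2) (- (w ^ 2) / 4) / (y ^ k * csqrt y)"
  have "has_bochner_integral lborel (\<lambda>v::real. exp (2 * (of_nat k + 1/2 :: complex) * v) * damped_cosine y w v)
           (Gamma (of_nat k + 1/2) * hyp1F1 (of_nat k + 1/2) (1/2) (- (w ^ 2) / 4) * y powr (- (of_nat k + 1/2)) / 2)"
    by (rule Mellin_damped_cosine) (use y in simp_all)
  moreover have "exp (2 * (of_nat k + 1/2 :: complex) * of_real v) * damped_cosine y w v = exp v *\<^sub>R f (exp v)" for v
  proof -
    have "2 * (of_nat k + 1/2 :: complex) * of_real v = of_nat (2 * k) * of_real v + complex_of_real v"
      by (simp add: algebra_simps)
    then have "exp (2 * (of_nat k + 1/2 :: complex) * of_real v) = of_real (exp v) ^ (2 * k) * of_real (exp v)"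
      by (simp only: exp_add exp_of_nat_mult exp_of_real)
    moreover have "exp (2 * v) = exp v ^ 2" by (simp add: power2_eq_square flip: exp_add)
    ultimately show ?thesis
      by (simp add: damped_cosine_def f_def scaleR_conv_of_real mult_ac)
  qed
  ultimately have "has_bochner_integral lborel (\<lambda>v. exp v *\<^sub>R f (exp v)) (I / 2)"
    by (simp only: powr_minus_nat_plus_half[OF y] I_def) (simp add: mult_ac)
  then have "has_bochner_integral lborel (\<lambda>r. indicator {0<..} r *\<^sub>R f r) (I / 2)"
  proof (subst (asm) has_bochner_integral_substitution)
    show "continuous_on (range exp) f" unfolding f_def by (intro continuous_intros)
  qed (auto simp: range_exp_real intro!: continuous_intros derivative_eq_intros)
  then have "has_bochner_integral lborel (\<lambda>r. indicator {0..} r *\<^sub>R f r) (I / 2)"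
    by (rule has_bochner_integral_discrete_difference[where X="{0}", THEN iffD1, rotated 4])
       (auto split: split_indicator)
  then have "has_bochner_integral lborel f (2 *\<^sub>R (I / 2))"
    by (rule has_bochner_integral_even_function) (simp add: f_def)
  moreover have "2 *\<^sub>R (I / 2) = I" by (simp add: scaleR_conv_of_real)
  ultimately show ?thesis by (simp only: f_def[abs_def] I_def)
qed

lemma hyp1F1_self: 
  assumes "\<And>n. pochhammer a n \<noteq> 0"
  shows "hyp1F1 a a u = exp u"
proof -
  have "pochhammer a n * u ^ n / (pochhammer a n * fact n) = u ^ n /\<^sub>R fact n" for n
    using assms[of n] by (simp add: scaleR_conv_of_real divide_inverse)
  then show ?thesis unfolding hyp1F1_def exp_def by simp
qed

lemma pochhammer_half_nonzero: "pochhammer (1/2 :: complex) n \<noteq> 0"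
proof
  assume "pochhammer (1/2 :: complex) n = 0"
  then obtain k where "(1/2 :: complex) = - of_nat k" by (auto simp: pochhammer_eq_0_iff)
  from arg_cong[OF this, of Re] show False by simp
qed

lemma hyp1F1_three_halves: "hyp1F1 (3/2) (1/2) u = (1 + 2 * u) * exp u"
proof -
  have p: "pochhammer (3/2 :: complex) n = (1 + 2 * of_nat n) * pochhammer (1/2) n" for n
  proof -
    have "1/2 * pochhammer (3/2 :: complex) n = pochhammer (1/2) n * (1/2 + of_nat n)"
      using pochhammer_rec[of "1/2 :: complex" n] pochhammer_Suc[of "1/2 :: complex" n] by simp
    then have "2 * (1/2 * pochhammer (3/2 :: complex) n) = 2 * (pochhammer (1/2) n * (1/2 + of_nat n))"
      by (simp only:)
    then show ?thesis by (simp add: algebra_simps)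
  qed
  have s: "(\<lambda>n. u ^ n / fact n) sums exp u"
    using exp_converges[of u] by (simp add: scaleR_conv_of_real divide_inverse mult_ac)
  have s2: "(\<lambda>n. of_nat n * (u ^ n / fact n)) sums (u * exp u)"
  proof -
    have "(\<lambda>n. of_nat (Suc n) * (u ^ Suc n / fact (Suc n))) sums (u * exp u)"
    proof -
      have "of_nat (Suc n) * (u ^ Suc n / fact (Suc n)) = u * (u ^ n / fact n)" for n
        unfolding fact_Suc power_Suc by (simp del: of_nat_Suc)
      then show ?thesis using sums_mult[OF s, of u] by (simp only:)
    qed
    from sums_Suc[OF this] show ?thesis by simp
  qed
  have "(\<lambda>n. u ^ n / fact n + 2 * (of_nat n * (u ^ n / fact n))) sums (exp u + 2 * (u * exp u))"
    by (intro sums_add sums_mult s s2)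
  moreover have "u ^ n / fact n + 2 * (of_nat n * (u ^ n / fact n)) = pochhammer (3/2) n * u ^ n / (pochhammer (1/2) n * fact n)" for n
    unfolding p using pochhammer_half_nonzero[of n] by (simp add: divide_simps) (simp add: algebra_simps)
  ultimately show ?thesis unfolding hyp1F1_def by (simp add: sums_iff algebra_simps)
qed

text \<open>
The imaginary part is odd, so averaging with the reflected integrand leaves the cosine moment.
\<close>

lemma Fourier_Gaussian:
  fixes x :: real
  shows "has_bochner_integral lborel (\<lambda>q::real. exp (- of_real (q\<^sup>2)) * exp (\<i> * of_real (x * q)))
           (of_real (sqrt pi * exp (- x\<^sup>2 / 4)))"
proof -
  define h :: "real \<Rightarrow> complex" where "h q = exp (- of_real (q\<^sup>2)) * exp (\<i> * of_real (x * q))" for q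
  have "has_bochner_integral lborel
     (\<lambda>r::real. exp (- 1 * of_real r ^ 2) * cos (0 * csqrt 1 * of_real r) * of_real r ^ (2 * 0))
     (Gamma (of_nat 0 + 1/2) * hyp1F1 (of_nat 0 + 1/2) (1/2) (- (0 ^ 2) / 4) / (1 ^ 0 * csqrt 1))"
    by (rule Gaussian_cos_moment) simp
  then have "integrable lborel (\<lambda>r::real. exp (- (of_real r ^ 2)) :: complex)"
    by (simp add: has_bochner_integral_iff)
  then have int: "integrable lborel h"
    by (rule Bochner_Integration.integrable_bound) (auto simp: h_def norm_mult intro!: borel_measurable_continuous_onI continuous_intros)
  then have 1: "has_bochner_integral lborel h (integral\<^sup>L lborel h)"
    by (rule has_bochner_integral_integrable)
  then have 2: "has_bochner_integral lborel (\<lambda>q. h (0 + (-1) * q)) (integral\<^sup>L lborel h /\<^sub>R \<bar>-1\<bar>)"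
    by (subst lborel_has_bochner_integral_real_affine_iff[symmetric]) auto
  have "has_bochner_integral lborel (\<lambda>q. h q + h (0 + (-1) * q)) (integral\<^sup>L lborel h + integral\<^sup>L lborel h /\<^sub>R \<bar>-1\<bar>)"
    by (rule has_bochner_integral_add[OF 1 2])
  moreover have "h q + h (0 + (-1) * q) = 2 * (exp (- 1 * of_real q ^ 2) * cos (of_real x * csqrt 1 * of_real q) * of_real q ^ (2 * 0))" for q
    by (simp add: h_def cos_exp_eq distrib_left)
  ultimately have "has_bochner_integral lborel
      (\<lambda>q. 2 * (exp (- 1 * of_real q ^ 2) * cos (of_real x * csqrt 1 * of_real q) * of_real q ^ (2 * 0))) (2 * integral\<^sup>L lborel h)"
    by simp
  moreover have "has_bochner_integral lborel
      (\<lambda>q. 2 * (exp (- 1 * of_real q ^ 2) * cos (of_real x * csqrt 1 * of_real q) * of_real q ^ (2 * 0)))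
     (2 * (Gamma (of_nat 0 + 1/2) * hyp1F1 (of_nat 0 + 1/2) (1/2) (- (of_real x ^ 2) / 4) / (1 ^ 0 * csqrt 1)))"
    by (intro has_bochner_integral_mult_right Gaussian_cos_moment) simp
  ultimately have "2 * integral\<^sup>L lborel h = 2 * (Gamma (of_nat 0 + 1/2) * hyp1F1 (of_nat 0 + 1/2) (1/2) (- (of_real x ^ 2) / 4) / (1 ^ 0 * csqrt 1))"
    by (rule has_bochner_integral_eq)
  then have "integral\<^sup>L lborel h = of_real (sqrt pi * exp (- x\<^sup>2 / 4))"
    by (simp add: hyp1F1_self pochhammer_half_nonzero Gamma_one_half_complex flip: exp_of_real)
  with 1 show ?thesis by (simp add: h_def[abs_def])
qed

section \<open>Fourier inversion and Parseval\<close>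

text \<open>
The integrability hypothesis of Fubini's theorem for the double integrals of Fourier analysis, with
\<open>k\<close> a unimodular exponential.
\<close>

lemma integrable_product_times_bounded:
  fixes f h :: "real \<Rightarrow> complex" and k :: "real \<Rightarrow> real \<Rightarrow> complex"
  assumes f: "integrable lborel f" and h: "integrable lborel h"
    and k: "continuous_on UNIV (\<lambda>(x, y). k x y)" "\<And>x y. norm (k x y) \<le> 1"
  shows "integrable (lborel \<Otimes>\<^sub>M lborel) (\<lambda>(x, y). f x * h y * k x y)"
proof -
  have [measurable]: "f \<in> borel_measurable borel" "h \<in> borel_measurable borel"
    using f h by (auto dest: borel_measurable_integrable)
  have [measurable]: "(\<lambda>(x, y). k x y) \<in> borel_measurable (borel \<Otimes>\<^sub>M borel)"
    unfolding borel_prod by (rule borel_measurable_continuous_onI[OF k(1)])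
  have "integrable (lborel \<Otimes>\<^sub>M lborel) (\<lambda>p. f (fst p) * h (snd p))"
  proof (rule lborel_pair.Fubini_integrable)
    show "integrable lborel (\<lambda>x. \<integral>y. norm (f (fst (x, y)) * h (snd (x, y))) \<partial>lborel)"
      using f by (simp add: norm_mult)
    show "AE x in lborel. integrable lborel (\<lambda>y. f (fst (x, y)) * h (snd (x, y)))"
      using h by simp
  qed measurable
  then show ?thesis
  proof (rule Bochner_Integration.integrable_bound)
    show "AE p in lborel \<Otimes>\<^sub>M lborel. norm (case p of (x, y) \<Rightarrow> f x * h y * k x y) \<le> norm (f (fst p) * h (snd p))"
    proof (rule AE_I2)
      fix p :: "real \<times> real"
      show "norm (case p of (x, y) \<Rightarrow> f x * h y * k x y) \<le> norm (f (fst p) * h (snd p))"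
        using mult_left_mono[OF k(2)[of "fst p" "snd p"], of "norm (f (fst p) * h (snd p))"]
        by (simp add: case_prod_beta norm_mult)
    qed
  qed measurable
qed

lemma Fourier_Gaussian_scaled:
  fixes x b :: real
  assumes b: "b > 0"
  shows "has_bochner_integral lborel (\<lambda>t::real. exp (- of_real ((t / b)\<^sup>2)) * exp (\<i> * of_real (x * t)))
           (of_real (b * sqrt pi * exp (- (b * x)\<^sup>2 / 4)))"
proof -
  have "has_bochner_integral lborel
     (\<lambda>t::real. exp (- of_real (((0 + (1/b) * t))\<^sup>2)) * exp (\<i> * of_real (b * x * (0 + (1/b) * t))))
     (of_real (sqrt pi * exp (- (b * x)\<^sup>2 / 4)) /\<^sub>R \<bar>1/b\<bar>)"
    by (subst lborel_has_bochner_integral_real_affine_iff[symmetric]) (use b Fourier_Gaussian[of "b * x"] in auto)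
  moreover have "b * x * (0 + (1/b) * t) = x * t" "0 + (1/b) * t = t / b" for t
    using b by auto
  ultimately show ?thesis using b by (simp add: scaleR_conv_of_real mult_ac)
qed

text \<open>
Gaussian regularisation: damping the inversion integral by \<open>exp (- (t / b)\<^sup>2)\<close> permits Fubini's theorem
and convolves \<open>g\<close> with a Gaussian of width \<open>1 / b\<close>, which tends to \<open>g\<close> as \<open>b\<close> grows; the undamped
integral is recovered by dominated convergence.
\<close>

lemma Fourier_inversion:
  fixes g G :: "real \<Rightarrow> complex"
  assumes g: "integrable lborel g" and cont: "continuous_on UNIV g" and bdd: "\<And>v. norm (g v) \<le> B"
    and G: "\<And>t. G t = (\<integral>v. g v * exp (\<i> * of_real (t * v)) \<partial>lborel)" and Gint: "integrable lborel G"
  shows "(\<integral>t. G t * exp (- \<i> * of_real (t * x)) \<partial>lborel) = of_real (2 * pi) * g x"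
proof -
  define b where "b m = real (Suc m)" for m
  have b: "b m > 0" for m by (simp add: b_def)
  have blim: "(\<lambda>m. c / b m) \<longlonglongrightarrow> 0" for c
    unfolding b_def by (intro LIMSEQ_Suc lim_const_over_n)
  define E where "E m t = exp (- complex_of_real ((t / b m)\<^sup>2))" for m t
  have E1: "norm (E m t) \<le> 1" for m t by (simp add: E_def)
  have Econt: "continuous_on A (E m)" for m A
    unfolding E_def using b[of m] by (intro continuous_intros) auto
  have [measurable]: "E m \<in> borel_measurable borel" for m
    by (rule borel_measurable_continuous_onI[OF Econt])
  have [measurable]: "g \<in> borel_measurable borel" "G \<in> borel_measurable borel"
    using g Gint by (auto dest: borel_measurable_integrable)
  have Eint: "integrable lborel (E m)" for m
    using Fourier_Gaussian_scaled[OF b[of m], of 0] by (simp add: E_def[abs_def] has_bochner_integral_iff)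
  define J where "J m = (\<integral>t. G t * exp (- \<i> * of_real (t * x)) * E m t \<partial>lborel)" for m
  have lim1: "J \<longlonglongrightarrow> (\<integral>t. G t * exp (- \<i> * of_real (t * x)) \<partial>lborel)"
    unfolding J_def
  proof (rule integral_dominated_convergence[where w = "\<lambda>t. norm (G t)"])
    show "AE t in lborel. (\<lambda>m. G t * exp (- \<i> * of_real (t * x)) * E m t) \<longlonglongrightarrow> G t * exp (- \<i> * of_real (t * x))"
    proof (rule AE_I2)
      fix t
      have "(\<lambda>m. G t * exp (- \<i> * of_real (t * x)) * E m t) \<longlonglongrightarrow>
         G t * exp (- \<i> * of_real (t * x)) * exp (- complex_of_real (0\<^sup>2))"
        unfolding E_def by (intro tendsto_intros blim)
      then show "(\<lambda>m. G t * exp (- \<i> * of_real (t * x)) * E m t) \<longlonglongrightarrow> G t * exp (- \<i> * of_real (t * x))"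
        by simp
    qed
    show "AE t in lborel. norm (G t * exp (- \<i> * of_real (t * x)) * E m t) \<le> norm (G t)" for m
      using mult_left_mono[OF E1, of "norm (G _)"] by (simp add: norm_mult)
  qed (use Gint in \<open>auto intro: integrable_norm\<close>)
  have Jeq: "J m = of_real (2 * sqrt pi) * (\<integral>s. g (x + (2 / b m) * s) * exp (- of_real (s\<^sup>2)) \<partial>lborel)" for m
  proof -
    define k where "k v t = exp (\<i> * of_real ((v - x) * t))" for v t :: real
    have ip: "integrable (lborel \<Otimes>\<^sub>M lborel) (\<lambda>(v, t). g v * E m t * k v t)"
      by (rule integrable_product_times_bounded[OF g Eint])
         (auto simp: k_def case_prod_beta intro!: continuous_intros)
    have "J m = (\<integral>t. (\<integral>v. g v * E m t * k v t \<partial>lborel) \<partial>lborel)"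
    proof -
      have "G t * exp (- \<i> * of_real (t * x)) * E m t = (\<integral>v. g v * E m t * k v t \<partial>lborel)" for t
      proof -
        have "G t * exp (- \<i> * of_real (t * x)) * E m t =
          (\<integral>v. g v * exp (\<i> * of_real (t * v)) * (exp (- \<i> * of_real (t * x)) * E m t) \<partial>lborel)"
          unfolding G integral_mult_left_zero by (simp only: mult.assoc)
        also have "\<dots> = (\<integral>v. g v * E m t * k v t \<partial>lborel)"
        proof (intro Bochner_Integration.integral_cong refl)
          fix v
          have "\<i> * of_real ((v - x) * t) = \<i> * of_real (t * v) + - \<i> * of_real (t * x)"
            by (simp add: algebra_simps)
          then have "k v t = exp (\<i> * of_real (t * v)) * exp (- \<i> * of_real (t * x))"
            unfolding k_def by (simp only: exp_add)
          then show "g v * exp (\<i> * of_real (t * v)) * (exp (- \<i> * of_real (t * x)) * E m t) = g v * E m t * k v t"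
            by (simp only: mult_ac)
        qed
        finally show ?thesis .
      qed
      then show ?thesis unfolding J_def by (simp only:)
    qed
    also have "\<dots> = (\<integral>v. (\<integral>t. g v * E m t * k v t \<partial>lborel) \<partial>lborel)"
      by (rule lborel_pair.Fubini_integral[OF ip])
    also have "\<dots> = (\<integral>v. g v * of_real (b m * sqrt pi * exp (- (b m * (v - x))\<^sup>2 / 4)) \<partial>lborel)"
    proof (intro Bochner_Integration.integral_cong refl)
      fix v
      show "(\<integral>t. g v * E m t * k v t \<partial>lborel) = g v * of_real (b m * sqrt pi * exp (- (b m * (v - x))\<^sup>2 / 4))"
        unfolding mult.assoc[of "g v"] integral_mult_right_zero E_def k_def
        by (simp only: has_bochner_integral_integral_eq[OF Fourier_Gaussian_scaled[OF b]])
    qed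
    \<comment> \<open>The substitution \<open>v = x + 2s/b\<close> makes the Gaussian weight independent of \<open>b\<close>.\<close>
    also have "\<dots> = \<bar>2 / b m\<bar> *\<^sub>R (\<integral>s. g (x + (2 / b m) * s) *
         of_real (b m * sqrt pi * exp (- (b m * ((x + (2 / b m) * s) - x))\<^sup>2 / 4)) \<partial>lborel)"
      by (rule lborel_integral_real_affine) (use b[of m] in auto)
    also have "(\<lambda>s. g (x + (2 / b m) * s) * of_real (b m * sqrt pi * exp (- (b m * ((x + (2 / b m) * s) - x))\<^sup>2 / 4)))
       = (\<lambda>s. of_real (b m * sqrt pi) * (g (x + (2 / b m) * s) * exp (- of_real (s\<^sup>2))))"
      using b[of m] by (simp add: fun_eq_iff power_mult_distrib exp_of_real [symmetric] del: exp_of_real)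
    also have "\<bar>2 / b m\<bar> *\<^sub>R (\<integral>s. of_real (b m * sqrt pi) * (g (x + (2 / b m) * s) * exp (- of_real (s\<^sup>2))) \<partial>lborel)
       = of_real (2 * sqrt pi) * (\<integral>s. g (x + (2 / b m) * s) * exp (- of_real (s\<^sup>2)) \<partial>lborel)"
      using b[of m] by (simp add: scaleR_conv_of_real)
    finally show ?thesis .
  qed
  have g0: "has_bochner_integral lborel (\<lambda>s. exp (- complex_of_real (s\<^sup>2))) (of_real (sqrt pi))"
    using Fourier_Gaussian[of 0] by simp
  have "(\<lambda>m. \<integral>s. g (x + (2 / b m) * s) * exp (- of_real (s\<^sup>2)) \<partial>lborel) \<longlonglongrightarrow> (\<integral>s. g x * exp (- of_real (s\<^sup>2)) \<partial>lborel)"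
  proof (rule integral_dominated_convergence[where w = "\<lambda>s. B * norm (exp (- complex_of_real (s\<^sup>2)))"])
    show "integrable lborel (\<lambda>s. B * norm (exp (- complex_of_real (s\<^sup>2))))"
      using g0 by (intro integrable_mult_right integrable_norm) (simp add: has_bochner_integral_iff)
    show "AE s in lborel. (\<lambda>m. g (x + (2 / b m) * s) * exp (- of_real (s\<^sup>2))) \<longlonglongrightarrow> g x * exp (- of_real (s\<^sup>2))"
    proof (rule AE_I2)
      fix s
      have "(\<lambda>m. x + (2 / b m) * s) \<longlonglongrightarrow> x + 0 * s" by (intro tendsto_intros blim)
      moreover have "isCont g x" using cont by (simp add: continuous_on_eq_continuous_at)
      ultimately have "(\<lambda>m. g (x + (2 / b m) * s)) \<longlonglongrightarrow> g x"
        by (intro isCont_tendsto_compose[of _ g]) auto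
      then show "(\<lambda>m. g (x + (2 / b m) * s) * exp (- of_real (s\<^sup>2))) \<longlonglongrightarrow> g x * exp (- of_real (s\<^sup>2))"
        by (intro tendsto_intros)
    qed
    show "AE s in lborel. norm (g (x + (2 / b m) * s) * exp (- of_real (s\<^sup>2))) \<le> B * norm (exp (- complex_of_real (s\<^sup>2)))" for m
      unfolding norm_mult by (intro AE_I2 mult_right_mono bdd) auto
    show "(\<lambda>s. g x * exp (- complex_of_real (s\<^sup>2))) \<in> borel_measurable lborel"
      "(\<lambda>s. g (x + (2 / b m) * s) * exp (- of_real (s\<^sup>2))) \<in> borel_measurable lborel" for m
      by (auto intro!: borel_measurable_continuous_onI continuous_intros continuous_on_compose2[OF cont])
  qed
  also have "(\<integral>s. g x * exp (- of_real (s\<^sup>2)) \<partial>lborel) = g x * of_real (sqrt pi)"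
    by (rule has_bochner_integral_integral_eq[OF has_bochner_integral_mult_right[OF g0]])
  finally have "J \<longlonglongrightarrow> of_real (2 * sqrt pi) * (g x * of_real (sqrt pi))"
    unfolding Jeq[abs_def] by (intro tendsto_intros)
  moreover have "of_real (2 * sqrt pi) * (g x * of_real (sqrt pi)) = of_real (2 * pi) * g x"
  proof -
    have "complex_of_real (sqrt pi) * of_real (sqrt pi) = of_real pi"
      by (simp flip: of_real_mult)
    then show ?thesis by (simp add: mult_ac)
  qed
  ultimately show ?thesis using LIMSEQ_unique[OF lim1] by simp
qed

text \<open>
Only one of the two transforms has to be integrable: the other one is expanded under the integral,
and the inversion formula is applied to the integrable one.
\<close>

lemma Fourier_Parseval:
  fixes f g F G :: "real \<Rightarrow> complex"
  assumes f: "integrable lborel f"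
    and g: "integrable lborel g" and cont: "continuous_on UNIV g" and bdd: "\<And>v. norm (g v) \<le> B"
    and F: "\<And>t. F t = (\<integral>v. f v * exp (\<i> * of_real (t * v)) \<partial>lborel)"
    and G: "\<And>t. G t = (\<integral>v. g v * exp (\<i> * of_real (t * v)) \<partial>lborel)" and Gint: "integrable lborel G"
  shows "(\<integral>t. F t * G t \<partial>lborel) = of_real (2 * pi) * (\<integral>v. f v * g (- v) \<partial>lborel)"
proof -
  define k where "k v t = exp (\<i> * of_real (t * v))" for v t :: real
  have ip: "integrable (lborel \<Otimes>\<^sub>M lborel) (\<lambda>(v, t). f v * G t * k v t)"
    by (rule integrable_product_times_bounded[OF f Gint])
       (auto simp: k_def case_prod_beta intro!: continuous_intros)
  have "(\<integral>t. F t * G t \<partial>lborel) = (\<integral>t. (\<integral>v. f v * G t * k v t \<partial>lborel) \<partial>lborel)"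
  proof -
    have "F t * G t = (\<integral>v. f v * G t * k v t \<partial>lborel)" for t
    proof -
      have "F t * G t = (\<integral>v. f v * exp (\<i> * of_real (t * v)) * G t \<partial>lborel)"
        unfolding F by simp
      also have "\<dots> = (\<integral>v. f v * G t * k v t \<partial>lborel)"
        by (intro Bochner_Integration.integral_cong refl) (simp only: k_def mult_ac)
      finally show ?thesis .
    qed
    then show ?thesis by (simp only:)
  qed
  also have "\<dots> = (\<integral>v. (\<integral>t. f v * G t * k v t \<partial>lborel) \<partial>lborel)"
    by (rule lborel_pair.Fubini_integral[OF ip])
  also have "\<dots> = (\<integral>v. of_real (2 * pi) * (f v * g (- v)) \<partial>lborel)"
  proof (intro Bochner_Integration.integral_cong refl)
    fix v
    have "(\<integral>t. f v * G t * k v t \<partial>lborel) = f v * (\<integral>t. G t * exp (- \<i> * of_real (t * (- v))) \<partial>lborel)"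
      by (simp add: k_def mult.assoc)
    also have "\<dots> = of_real (2 * pi) * (f v * g (- v))"
      unfolding Fourier_inversion[OF g cont bdd G Gint] by (simp only: mult_ac)
    finally show "(\<integral>t. f v * G t * k v t \<partial>lborel) = of_real (2 * pi) * (f v * g (- v))" .
  qed
  also have "\<dots> = of_real (2 * pi) * (\<integral>v. f v * g (- v) \<partial>lborel)"
    by (simp only: integral_mult_right_zero)
  finally show ?thesis .
qed

section \<open>Decay of the Mellin transform\<close>

lemma integrable_exp_minus_abs:
  fixes \<kappa> :: real
  assumes "\<kappa> > 0"
  shows "integrable lborel (\<lambda>t::real. exp (- \<kappa> * \<bar>t\<bar>))"
proof -
  have i: "((\<lambda>t. exp (- \<kappa> * t)) has_integral exp (- \<kappa> * 0) / \<kappa>) {0..}"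
    by (rule has_integral_exp_minus_to_infinity[OF assms])
  have "(\<lambda>t. exp (- \<kappa> * t)) absolutely_integrable_on {0..}"
    by (rule nonnegative_absolutely_integrable_1) (use i in auto)
  moreover have "(\<lambda>t::real. indicator {0..} t *\<^sub>R exp (- \<kappa> * t)) \<in> borel_measurable borel"
    by (rule borel_measurable_continuous_on_indicator) (auto intro!: continuous_intros)
  ultimately have "integrable lborel (\<lambda>t::real. indicator {0..} t *\<^sub>R exp (- \<kappa> * t))"
    unfolding set_integrable_def by (subst (asm) integrable_completion) auto
  also have "(\<lambda>t::real. indicator {0..} t *\<^sub>R exp (- \<kappa> * t)) = (\<lambda>t. indicator {0..} t *\<^sub>R exp (- \<kappa> * \<bar>t\<bar>))"
    by (auto simp: fun_eq_iff split: split_indicator)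
  finally have "has_bochner_integral lborel (\<lambda>t. exp (- \<kappa> * \<bar>t\<bar>))
     (2 *\<^sub>R integral\<^sup>L lborel (\<lambda>t::real. indicator {0..} t *\<^sub>R exp (- \<kappa> * \<bar>t\<bar>)))"
    by (intro has_bochner_integral_even_function has_bochner_integral_integrable) auto
  then show ?thesis by (simp add: has_bochner_integral_iff)
qed

lemma continuous_on_damped_cosine [continuous_intros]: "continuous_on A (damped_cosine y w)"
  unfolding damped_cosine_def by (intro continuous_intros)

text \<open>
With \<open>q = e\<^sup>v\<close> the modulus is at most the exponential of a quadratic polynomial in \<open>q\<close> with negative
leading coefficient, as \<open>v \<le> e\<^sup>v\<close>.
\<close>

lemma damped_cosine_bounded:
  fixes y w \<sigma> :: complex
  assumes y: "Re y > 0" and \<sigma>: "Re \<sigma> > 0"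
  shows "\<exists>B. \<forall>v::real. norm (exp (\<sigma> * v) * damped_cosine y w v) \<le> B"
proof (intro exI allI)
  fix v :: real
  define r where "r = Re \<sigma> + norm (w * csqrt y)"
  define q where "q = exp v"
  define p where "p = Re y"
  have p: "p > 0" using y by (simp add: p_def)
  have "Re \<sigma> * v \<le> Re \<sigma> * q"
  proof (rule mult_left_mono)
    show "v \<le> q" using exp_ge_add_one_self[of v] unfolding q_def by linarith
  qed (use \<sigma> in simp)
  moreover have "norm (cos (w * csqrt y * of_real (exp v))) \<le> exp (norm (w * csqrt y) * q)"
    using norm_cos_le[of "w * csqrt y * of_real (exp v)"] by (simp add: norm_mult q_def)
  moreover have "exp (2 * v) = q\<^sup>2" by (simp add: q_def power2_eq_square flip: exp_add)
  ultimately have "norm (exp (\<sigma> * v) * damped_cosine y w v) \<le> exp (Re \<sigma> * q) * (exp (- (p * q\<^sup>2)) * exp (norm (w * csqrt y) * q))"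
    unfolding damped_cosine_def norm_mult norm_exp_eq_Re
    by (intro mult_mono) (auto simp: p_def)
  also have "\<dots> = exp (r * q - p * q\<^sup>2)"
    by (simp add: r_def algebra_simps flip: exp_add)
  also have "r * q - p * q\<^sup>2 = r\<^sup>2 / (4 * p) - p * (q - r / (2 * p))\<^sup>2"
    using p by (simp add: power2_eq_square field_simps)
  also have "\<dots> \<le> r\<^sup>2 / (4 * p)" using p by simp
  finally show "norm (exp (\<sigma> * v) * damped_cosine y w v) \<le> exp ((Re \<sigma> + norm (w * csqrt y))\<^sup>2 / (4 * Re y))"
    by (simp add: r_def p_def)
qed

lemma damped_cosine_Fourier_transform:
  fixes y w \<sigma> :: complex and t :: real
  assumes y: "Re y > 0" and \<sigma>: "Re \<sigma> > 0"
  defines "a \<equiv> (\<sigma> + \<i> * of_real t) / 2"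
  shows "(\<integral>v. exp (\<sigma> * of_real v) * damped_cosine y w v * exp (\<i> * of_real (t * v)) \<partial>lborel)
     = Gamma a * hyp1F1 a (1/2) (- (w ^ 2) / 4) * y powr (- a) / 2"
proof -
  have "(\<integral>v. exp (2 * a * of_real v) * damped_cosine y w v \<partial>lborel) = Gamma a * hyp1F1 a (1/2) (- (w ^ 2) / 4) * y powr (- a) / 2"
    by (rule has_bochner_integral_integral_eq[OF Mellin_damped_cosine]) (use y \<sigma> in \<open>auto simp: a_def\<close>)
  moreover have "exp (2 * a * of_real v) * damped_cosine y w v = exp (\<sigma> * of_real v) * damped_cosine y w v * exp (\<i> * of_real (t * v))" for v
  proof -
    have "2 * a * of_real v = \<sigma> * of_real v + \<i> * of_real (t * v)"
      by (simp add: a_def distrib_right)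
    then show ?thesis by (simp only: exp_add mult_ac)
  qed
  ultimately show ?thesis by simp
qed

lemma damped_cosine_integrable:
  fixes y w \<sigma> :: complex
  assumes y: "Re y > 0" and \<sigma>: "Re \<sigma> > 0"
  shows "integrable lborel (\<lambda>v::real. exp (\<sigma> * of_real v) * damped_cosine y w v)"
  using Mellin_damped_cosine[of "\<sigma>/2" y w] assms by (auto simp: has_bochner_integral_iff)

lemma Ln_times_cis:
  assumes "y \<noteq> 0" "\<bar>Arg y + \<theta>\<bar> < pi"
  shows "Ln (y * cis \<theta>) = Ln y + \<i> * of_real \<theta>"
proof (rule Ln_unique)
  show "exp (Ln y + \<i> * of_real \<theta>) = y * cis \<theta>"
    using assms by (simp add: exp_add cis_conv_exp)
qed (use assms in \<open>auto simp: Arg_eq_Im_Ln\<close>)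

lemma powr_times_cis:
  fixes y a :: complex
  assumes "y \<noteq> 0" "\<bar>Arg y + \<theta>\<bar> < pi"
  shows "(y * cis \<theta>) powr a = y powr a * exp (\<i> * of_real \<theta> * a)"
  using assms by (simp add: powr_def Ln_times_cis distrib_left exp_add mult_ac)

lemma Re_pos_of_Arg:
  assumes "y \<noteq> 0" "\<bar>Arg y\<bar> < pi / 2"
  shows "Re y > 0"
  using assms Re_Ln_pos_lt[of y] by (simp add: Arg_eq_Im_Ln)

text \<open>
The transforms for \<open>y\<close> and for \<open>y * cis \<theta>\<close> differ by the explicit factor \<open>exp (\<i> \<theta> a)\<close> only, and the
latter is bounded by an \<open>L\<^sup>1\<close> norm. Choosing the sign of \<open>\<theta> = \<plusminus>\<pi>/4\<close> according to the sign of \<open>t\<close> gives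
exponential decay in both directions. The restriction on \<open>Arg y\<close> keeps \<open>y * cis \<theta>\<close> in the right
half-plane.
\<close>

lemma damped_cosine_Fourier_integrable:
  fixes y w \<sigma> :: complex
  assumes y0: "y \<noteq> 0" and y: "\<bar>Arg y\<bar> < pi / 4" and \<sigma>: "Re \<sigma> > 0"
  shows "integrable lborel
    (\<lambda>t::real. \<integral>v. exp (\<sigma> * of_real v) * damped_cosine y w v * exp (\<i> * of_real (t * v)) \<partial>lborel)"
proof -
  define M where "M y t = (\<integral>v. exp (\<sigma> * of_real v) * damped_cosine y w v * exp (\<i> * of_real (t * v)) \<partial>lborel)" for y t
  define N where "N y = (\<integral>v. norm (exp (\<sigma> * of_real v) * damped_cosine y w v) \<partial>lborel)" for y
  have N0: "N y \<ge> 0" for y unfolding N_def by simp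
  have Re0: "Re y > 0" using Re_pos_of_Arg[OF y0] y by simp
  have "pi > 0" by simp
  have bound: "norm (M y t) \<le> N (y * cis \<theta>) * exp (- \<theta> * (t + Im \<sigma>) / 2)" if \<theta>: "\<theta> \<in> {- pi / 4, pi / 4}" for \<theta> t
  proof -
    define a where "a = (\<sigma> + \<i> * of_real t) / 2"
    have arg: "\<bar>Arg y + \<theta>\<bar> < pi / 2" using y that \<open>pi > 0\<close> by auto
    then have arg': "\<bar>Arg y + \<theta>\<bar> < pi" using \<open>pi > 0\<close> by linarith
    have Arg: "Arg (y * cis \<theta>) = Arg y + \<theta>"
      using y0 Ln_times_cis[OF y0 arg'] by (simp add: Arg_eq_Im_Ln)
    have Re\<theta>: "Re (y * cis \<theta>) > 0"
      by (rule Re_pos_of_Arg) (use y0 arg Arg in auto)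
    have "M y t = M (y * cis \<theta>) t * exp (\<i> * of_real \<theta> * a)"
      unfolding M_def damped_cosine_Fourier_transform[OF Re0 \<sigma>] damped_cosine_Fourier_transform[OF Re\<theta> \<sigma>]
        a_def[symmetric] powr_times_cis[OF y0 arg'] by (simp flip: exp_add)
    moreover have "norm (exp (\<i> * of_real \<theta> * a)) = exp (- \<theta> * (t + Im \<sigma>) / 2)"
      by (simp add: a_def field_simps)
    moreover have "norm (M (y * cis \<theta>) t) \<le> N (y * cis \<theta>)"
    proof -
      have "norm (M (y * cis \<theta>) t) \<le> (\<integral>v. norm (exp (\<sigma> * of_real v) * damped_cosine (y * cis \<theta>) w v * exp (\<i> * of_real (t * v))) \<partial>lborel)"
        unfolding M_def by (rule integral_norm_bound)
      also have "\<dots> = N (y * cis \<theta>)" unfolding N_def by (simp add: norm_mult)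
      finally show ?thesis .
    qed
    ultimately show ?thesis by (simp only: norm_mult mult_right_mono exp_ge_zero)
  qed
  define C where "C = (N (y * cis (pi / 4)) + N (y * cis (- pi / 4))) * exp (pi / 8 * \<bar>Im \<sigma>\<bar>)"
  have "norm (M y t) \<le> norm (C * exp (- (pi / 8) * \<bar>t\<bar>))" for t
  proof -
    \<comment> \<open>The turn whose factor \<open>exp (- \<theta> t / 2)\<close> decays on the half-line containing \<open>t\<close>.\<close>
    define \<theta> where "\<theta> = (if t \<ge> 0 then pi / 4 else - pi / 4)"
    have "- \<theta> * t = - (pi / 4) * \<bar>t\<bar>" by (simp add: \<theta>_def)
    moreover have "- \<theta> * Im \<sigma> \<le> (pi / 4) * \<bar>Im \<sigma>\<bar>"
    proof -
      have "- \<theta> * Im \<sigma> \<le> \<bar>\<theta> * Im \<sigma>\<bar>" by simp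
      also have "\<dots> = (pi / 4) * \<bar>Im \<sigma>\<bar>" by (simp add: \<theta>_def abs_mult)
      finally show ?thesis .
    qed
    ultimately have "- \<theta> * (t + Im \<sigma>) / 2 \<le> pi / 8 * \<bar>Im \<sigma>\<bar> + - (pi / 8) * \<bar>t\<bar>"
      by (simp add: distrib_left)
    then have e: "exp (- \<theta> * (t + Im \<sigma>) / 2) \<le> exp (pi / 8 * \<bar>Im \<sigma>\<bar>) * exp (- (pi / 8) * \<bar>t\<bar>)"
      by (simp only: exp_le_cancel_iff mult_exp_exp)
    have "norm (M y t) \<le> N (y * cis \<theta>) * exp (- \<theta> * (t + Im \<sigma>) / 2)"
      by (rule bound) (simp add: \<theta>_def)
    also have "\<dots> \<le> (N (y * cis (pi / 4)) + N (y * cis (- pi / 4))) * (exp (pi / 8 * \<bar>Im \<sigma>\<bar>) * exp (- (pi / 8) * \<bar>t\<bar>))"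
      using N0 by (intro mult_mono e) (auto simp: \<theta>_def)
    also have "\<dots> = C * exp (- (pi / 8) * \<bar>t\<bar>)" by (simp add: C_def mult.assoc)
    finally show ?thesis by simp
  qed
  moreover have "integrable lborel (\<lambda>t. C * exp (- (pi / 8) * \<bar>t\<bar>))"
    by (intro integrable_mult_right integrable_exp_minus_abs) simp
  moreover have "M y \<in> borel_measurable lborel"
  proof -
    have [measurable]: "damped_cosine y w \<in> borel_measurable borel"
      by (intro borel_measurable_continuous_onI continuous_intros)
    have [measurable]: "(\<lambda>p::real \<times> real. exp (\<i> * of_real (fst p * snd p))) \<in> borel_measurable borel"
      "(\<lambda>v::real. exp (\<sigma> * of_real v)) \<in> borel_measurable borel"
      by (intro borel_measurable_continuous_onI continuous_intros)+
    have "(\<lambda>p. exp (\<sigma> * of_real (snd p)) * damped_cosine y w (snd p) * exp (\<i> * of_real (fst p * snd p)))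
        \<in> borel_measurable (lborel \<Otimes>\<^sub>M lborel)"
      using \<open>(\<lambda>p::real \<times> real. exp (\<i> * of_real (fst p * snd p))) \<in> borel_measurable borel\<close>
      unfolding borel_prod[symmetric] by measurable
    then show ?thesis
      unfolding M_def by (intro lborel.borel_measurable_lebesgue_integral) (simp add: case_prod_beta)
  qed
  ultimately have "integrable lborel (M y)"
    by (intro Bochner_Integration.integrable_bound[of lborel "\<lambda>t. C * exp (- (pi / 8) * \<bar>t\<bar>)" "M y"]) auto
  then show ?thesis by (simp add: M_def[abs_def])
qed

section \<open>The Bessel function as a Laplace integral\<close>

text \<open>
The factor \<open>2 powr (s - 2)\<close> cancels against the \<open>2\<close> in the argument, and \<open>x powr (- s)\<close> splits evenly
because the two Gamma arguments add up to \<open>s\<close>. Each bracket is then a Fourier transform of a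
\<open>damped_cosine\<close> times an exponential.
\<close>

lemma gen_bessel_integrand_factor:
  fixes x z w s :: complex
  assumes x: "x \<noteq> 0"
  shows "gen_bessel_integrand z w (2 * x) s =
    (Gamma ((s - z) / 2) * hyp1F1 ((s - z) / 2) (1/2) (- (w ^ 2) / 4) * x powr (- ((s - z) / 2)) / 2) *
    (Gamma ((s + z) / 2) * hyp1F1 ((s + z) / 2) (1/2) (- (w ^ 2) / 4) * x powr (- ((s + z) / 2)) / 2)"
proof -
  have "2 powr (s - 2) * (2 * x) powr (- s) = x powr (- s) / 4"
  proof -
    have "(2 * x) powr (- s) = 2 powr (- s) * x powr (- s)"
      by (rule powr_times_real_left) auto
    moreover have "(2 :: complex) powr (s - 2) * 2 powr (- s) = 2 powr (- 2)"
      by (simp flip: powr_add)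
    moreover have "(2 :: complex) powr (- 2) = 1 / 4" by (simp add: powr_minus)
    ultimately show ?thesis by (simp add: mult.assoc[symmetric])
  qed
  moreover have "x powr (- s) = x powr (- ((s - z) / 2)) * x powr (- ((s + z) / 2))"
    by (simp add: field_simps flip: powr_add)
  ultimately have "2 powr (s - 2) * (2 * x) powr (- s) = x powr (- ((s - z) / 2)) * x powr (- ((s + z) / 2)) / 4"
    by simp
  moreover have "g * g' * h * h' * p * q = (g * h * a / 2) * (g' * h' * b / 2)"
    if "p * q = a * b / 4" for g g' h h' p q a b :: complex
  proof -
    have "g * g' * h * h' * p * q = g * g' * h * h' * (a * b / 4)"
      using that by (simp only: mult.assoc)
    then show ?thesis by simp
  qed
  ultimately show ?thesis
    unfolding gen_bessel_integrand_def by blast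
qed

text \<open>
On the line \<open>s = c + \<i>t\<close> the two factors of the integrand are the Fourier transforms of
\<open>f(v) = exp ((c - z) v) \<phi>(e\<^sup>v)\<close> and \<open>g(v) = exp ((c + z) v) \<phi>(e\<^sup>v)\<close>, with \<open>\<phi>(e\<^sup>v)\<close> the damped cosine; the
condition \<open>c > |Re z|\<close> makes \<open>f\<close> and \<open>g\<close> integrable at \<open>v = -\<infinity>\<close>. In \<open>f(v) g(-v)\<close> the abscissa \<open>c\<close>
cancels.
\<close>

lemma gen_bessel_K_eq_integral:
  fixes x z w :: complex and c :: real
  assumes x0: "x \<noteq> 0" and x: "\<bar>Arg x\<bar> < pi / 4" and c: "c > \<bar>Re z\<bar>"
  shows "has_bochner_integral lborel
     (\<lambda>v::real. exp (- 2 * z * of_real v) * (damped_cosine x w v * damped_cosine x w (- v)))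
     (gen_bessel_K c z w (2 * x))"
proof -
  have Re: "Re x > 0" using Re_pos_of_Arg[OF x0] x by simp
  define f where "f v = exp ((of_real c - z) * of_real v) * damped_cosine x w v" for v :: real
  define g where "g v = exp ((of_real c + z) * of_real v) * damped_cosine x w v" for v :: real
  have c1: "Re (of_real c - z) > 0" and c2: "Re (of_real c + z) > 0" using c by auto
  define F where "F t = (\<integral>v. f v * exp (\<i> * of_real (t * v)) \<partial>lborel)" for t
  define G where "G t = (\<integral>v. g v * exp (\<i> * of_real (t * v)) \<partial>lborel)" for t
  have f: "integrable lborel f" and g: "integrable lborel g"
    unfolding f_def g_def by (intro damped_cosine_integrable Re c1 c2)+
  obtain B where B: "\<And>v. norm (g v) \<le> B"
    using damped_cosine_bounded[OF Re c2] unfolding g_def by blast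
  have gcont: "continuous_on UNIV g" unfolding g_def by (intro continuous_intros)
  have Gint: "integrable lborel G"
    unfolding G_def g_def by (rule damped_cosine_Fourier_integrable[OF x0 x c2])
  have "gen_bessel_integrand z w (2 * x) (Complex c t) = F t * G t" for t
  proof -
    have "(of_real c - z + \<i> * of_real t) / 2 = (Complex c t - z) / 2"
         "(of_real c + z + \<i> * of_real t) / 2 = (Complex c t + z) / 2"
      by (simp_all add: Complex_eq)
    then show ?thesis
      unfolding F_def G_def f_def g_def gen_bessel_integrand_factor[OF x0]
        damped_cosine_Fourier_transform[OF Re c1] damped_cosine_Fourier_transform[OF Re c2] by (simp only:)
  qed
  then have "gen_bessel_K c z w (2 * x) = 1 / (2 * of_real pi * \<i>) * ((\<integral>t. F t * G t \<partial>lborel) * \<i>)"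
    unfolding gen_bessel_K_def by simp
  also have "\<dots> = (\<integral>v. f v * g (- v) \<partial>lborel)"
    unfolding Fourier_Parseval[OF f g gcont B F_def G_def Gint] by simp
  finally have K: "gen_bessel_K c z w (2 * x) = (\<integral>v. f v * g (- v) \<partial>lborel)" .
  have "integrable lborel (\<lambda>v. f v * g (- v))"
  proof (rule Bochner_Integration.integrable_bound)
    show "integrable lborel (\<lambda>v. of_real B * f v)" using f by (rule integrable_mult_right)
    show "(\<lambda>v. f v * g (- v)) \<in> borel_measurable lborel"
      unfolding f_def g_def
      by (auto intro!: borel_measurable_continuous_onI continuous_intros continuous_on_compose2[OF continuous_on_damped_cosine])
    show "AE v in lborel. norm (f v * g (- v)) \<le> norm (of_real B * f v)"
    proof (rule AE_I2)
      fix v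
      have "norm (g (- v)) \<le> \<bar>B\<bar>" using B[of "- v"] by linarith
      then show "norm (f v * g (- v)) \<le> norm (of_real B * f v)"
        using mult_left_mono[of "norm (g (- v))" "\<bar>B\<bar>" "norm (f v)"] by (simp add: norm_mult mult.commute)
    qed
  qed
  then have "has_bochner_integral lborel (\<lambda>v. f v * g (- v)) (gen_bessel_K c z w (2 * x))"
    unfolding K by (rule has_bochner_integral_integrable)
  moreover have "f v * g (- v) = exp (- 2 * z * of_real v) * (damped_cosine x w v * damped_cosine x w (- v))" for v
  proof -
    have "(of_real c - z) * of_real v + (of_real c + z) * of_real (- v) = - 2 * z * of_real v"
      by (simp add: algebra_simps)
    then have "exp (- 2 * z * of_real v) = exp ((of_real c - z) * of_real v) * exp ((of_real c + z) * of_real (- v))"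
      by (simp only: mult_exp_exp)
    then show ?thesis unfolding f_def g_def by (simp only: mult_ac)
  qed
  ultimately show ?thesis by simp
qed

text \<open>
The exponents add up to \<open>-2x cosh (2v) = -2x - 4x sinh\<^sup>2 v\<close>, and the cosines combine by the
product-to-sum formula.
\<close>

lemma damped_cosine_product:
  fixes x w :: complex and v :: real
  shows "damped_cosine x w v * damped_cosine x w (- v) = exp (- 2 * x) / 2 * exp (- (4 * x) * of_real (sinh v) ^ 2) *
    (cos (2 * w * csqrt x * of_real (cosh v)) + cos (2 * w * csqrt x * of_real (sinh v)))"
proof -
  define p where "p = exp v"
  define q where "q = exp (- v)"
  have pq: "p * q = 1" by (simp add: p_def q_def flip: exp_add)
  have sc: "sinh v = (p - q) / 2" "cosh v = (p + q) / 2"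
    by (simp_all add: sinh_field_def cosh_field_def p_def q_def)
  have sq: "exp (2 * v) = p\<^sup>2" "exp (2 * - v) = q\<^sup>2"
    by (simp_all add: p_def q_def power2_eq_square flip: exp_add)
  have pq2: "p\<^sup>2 + q\<^sup>2 = 4 * (sinh v)\<^sup>2 + 2"
    using pq unfolding sc by (simp add: power2_eq_square field_simps)
  have "- x * of_real (p\<^sup>2) + - x * of_real (q\<^sup>2) = - x * of_real (p\<^sup>2 + q\<^sup>2)"
    by (simp only: of_real_add distrib_left)
  also have "\<dots> = - 2 * x + - (4 * x) * of_real (sinh v) ^ 2"
    unfolding pq2 by (simp add: distrib_left)
  finally have "- x * of_real (p\<^sup>2) + - x * of_real (q\<^sup>2) = - 2 * x + - (4 * x) * of_real (sinh v) ^ 2" .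
  then have e: "exp (- x * of_real (p\<^sup>2)) * exp (- x * of_real (q\<^sup>2)) = exp (- 2 * x) * exp (- (4 * x) * of_real (sinh v) ^ 2)"
    by (simp only: mult_exp_exp)
  have cc: "cos (w * csqrt x * of_real p) * cos (w * csqrt x * of_real q) =
     (cos (2 * w * csqrt x * of_real (sinh v)) + cos (2 * w * csqrt x * of_real (cosh v))) / 2"
  proof -
    have "w * csqrt x * of_real p - w * csqrt x * of_real q = 2 * w * csqrt x * of_real (sinh v)"
         "w * csqrt x * of_real p + w * csqrt x * of_real q = 2 * w * csqrt x * of_real (cosh v)"
      by (simp_all add: sc algebra_simps)
    then show ?thesis unfolding cos_times_cos by (simp only:)
  qed
  have "damped_cosine x w v * damped_cosine x w (- v) =
     (exp (- x * of_real (p\<^sup>2)) * exp (- x * of_real (q\<^sup>2))) *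
     (cos (w * csqrt x * of_real p) * cos (w * csqrt x * of_real q))"
    unfolding damped_cosine_def sq p_def[symmetric] q_def[symmetric] by (simp only: mult_ac)
  then show ?thesis unfolding e cc by (simp add: add.commute)
qed

text \<open>
The factor \<open>cosh (2zv)\<close> together with the Jacobian \<open>1 / cosh v\<close> of \<open>r = sinh v\<close>.
\<close>

definition cosh_weight :: "complex \<Rightarrow> real \<Rightarrow> complex" where
  "cosh_weight z r = cosh (2 * z * of_real (arsinh r)) / of_real (sqrt (1 + r\<^sup>2))"

lemma continuous_on_cosh_weight [continuous_intros]: "continuous_on A (cosh_weight z)"
proof -
  have "1 + r\<^sup>2 > 0" for r :: real by (rule add_pos_nonneg) auto
  then have "complex_of_real (sqrt (1 + r\<^sup>2)) \<noteq> 0" for r :: real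
    by (metis of_real_eq_0_iff real_sqrt_eq_zero_cancel_iff less_irrefl)
  then show ?thesis
    unfolding cosh_weight_def by (intro continuous_intros) auto
qed

text \<open>
Since the product of the two damped cosines is even in \<open>v\<close>, \<open>exp (-2zv)\<close> may be replaced by
\<open>cosh (2zv)\<close>. This removes all odd powers of \<open>r\<close> from the later expansion. Then \<open>r = sinh v\<close>.
\<close>

lemma gen_bessel_K_eq_Laplace_integral:
  fixes x z w :: complex and c :: real
  assumes x0: "x \<noteq> 0" and x: "\<bar>Arg x\<bar> < pi / 4" and c: "c > \<bar>Re z\<bar>"
  shows "has_bochner_integral lborel
     (\<lambda>r::real. exp (- 2 * x) / 2 * (exp (- (4 * x) * of_real r ^ 2) * cosh_weight z r *
        (cos (2 * w * csqrt x * of_real (sqrt (1 + r\<^sup>2))) + cos (2 * w * csqrt x * of_real r))))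
     (gen_bessel_K c z w (2 * x))"
proof -
  define K where "K = gen_bessel_K c z w (2 * x)"
  define E where "E v = damped_cosine x w v * damped_cosine x w (- v)" for v
  have 1: "has_bochner_integral lborel (\<lambda>v::real. exp (- 2 * z * of_real v) * E v) K"
    unfolding E_def K_def by (rule gen_bessel_K_eq_integral[OF assms])
  then have "has_bochner_integral lborel (\<lambda>v::real. exp (- 2 * z * of_real (0 + -1 * v)) * E (0 + -1 * v)) (K /\<^sub>R \<bar>-1\<bar>)"
    by (subst lborel_has_bochner_integral_real_affine_iff[symmetric]) auto
  then have 2: "has_bochner_integral lborel (\<lambda>v::real. exp (2 * z * of_real v) * E v) K"
    by (simp add: E_def mult.commute)
  have "has_bochner_integral lborel (\<lambda>v. 1/2 * (exp (2 * z * of_real v) * E v + exp (- 2 * z * of_real v) * E v)) (1/2 * (K + K))"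
    by (intro has_bochner_integral_mult_right has_bochner_integral_add 1 2)
  moreover have "1/2 * (exp (2 * z * of_real v) * E v + exp (- 2 * z * of_real v) * E v) = cosh (2 * z * of_real v) * E v" for v
    by (simp add: cosh_field_def distrib_right add_divide_distrib)
  ultimately have 3: "has_bochner_integral lborel (\<lambda>v. cosh (2 * z * of_real v) * E v) K" by simp
  define f where "f r = exp (- 2 * x) / 2 * (exp (- (4 * x) * of_real r ^ 2) * cosh_weight z r *
        (cos (2 * w * csqrt x * of_real (sqrt (1 + r\<^sup>2))) + cos (2 * w * csqrt x * of_real r)))" for r :: real
  have f: "cosh v *\<^sub>R f (sinh v) = cosh (2 * z * of_real v) * E v" for v
  proof -
    have c: "sqrt (1 + (sinh v)\<^sup>2) = cosh v"
      by (rule real_sqrt_unique) (simp_all add: cosh_square_eq)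
    have "of_real (cosh v) * cosh_weight z (sinh v) = cosh (2 * z * of_real v)"
      unfolding cosh_weight_def c arsinh_sinh_real using cosh_real_nonzero[of v] by simp
    then show ?thesis
      unfolding f_def E_def damped_cosine_product c scaleR_conv_of_real
      by (simp add: mult_ac)
  qed
  have range: "range (sinh :: real \<Rightarrow> real) = UNIV"
    by (metis sinh_arsinh_real surjI)
  have "continuous_on UNIV f"
    unfolding f_def by (intro continuous_intros)
  then have "has_bochner_integral lborel (\<lambda>v. cosh v *\<^sub>R f (sinh v)) K \<longleftrightarrow>
      has_bochner_integral lborel (\<lambda>r. indicator (range (sinh :: real \<Rightarrow> real)) r *\<^sub>R f r) K"
    by (intro has_bochner_integral_substitution)
       (auto simp: range cosh_real_pos intro!: continuous_intros derivative_eq_intros)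
  with 3 show ?thesis unfolding f range by (simp add: f_def[abs_def] K_def)
qed

section \<open>Normalised Gaussian means\<close>

lemma has_bochner_integral_Gaussian:
  fixes m :: real
  assumes m: "m > 0"
  shows "has_bochner_integral lborel (\<lambda>r::real. exp (- m * r\<^sup>2)) (sqrt (pi / m))"
proof -
  have "has_bochner_integral lborel (\<lambda>t::real. Re (exp (- of_real ((t / (1 / sqrt m))\<^sup>2)) * exp (\<i> * of_real (0 * t))))
      (Re (of_real (1 / sqrt m * sqrt pi * exp (- (1 / sqrt m * 0)\<^sup>2 / 4))))"
    by (intro has_bochner_integral_bounded_linear[OF bounded_linear_Re] Fourier_Gaussian_scaled) (use m in simp)
  moreover have "Re (exp (- of_real ((t / (1 / sqrt m))\<^sup>2)) * exp (\<i> * of_real (0 * t))) = exp (- m * t\<^sup>2)" for t :: real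
    using m by (simp add: power_mult_distrib Re_exp)
  moreover have "Re (of_real (1 / sqrt m * sqrt pi * exp (- (1 / sqrt m * 0)\<^sup>2 / 4))) = sqrt (pi / m)"
    using m by (simp add: real_sqrt_divide)
  ultimately show ?thesis by simp
qed

lemma Re_ge_half_norm:
  assumes x: "\<bar>Arg x\<bar> < pi / 4"
  shows "2 * Re x \<ge> norm x"
proof -
  have "cos (pi / 3) \<le> cos \<bar>Arg x\<bar>"
    by (rule cos_monotone_0_pi_le) (use x pi_gt_zero in linarith)+
  then have "1 / 2 \<le> cos (Arg x)" by (simp add: cos_60)
  moreover have "Re x = norm x * cos (Arg x)"
    using rcis_cmod_Arg[of x] by (metis Re_rcis)
  ultimately show ?thesis
    using mult_left_mono[of "1/2" "cos (Arg x)" "norm x"] by simp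
qed

text \<open>
The mean with respect to the complex Gaussian weight \<open>exp (- 4 x r\<^sup>2)\<close>, normalised so that the mean of
\<open>1\<close> is \<open>1\<close>.
\<close>

definition Gauss_mean :: "complex \<Rightarrow> (real \<Rightarrow> complex) \<Rightarrow> complex" where
  "Gauss_mean x g = 2 * csqrt x / of_real (sqrt pi) * (\<integral>r. exp (- (4 * x) * of_real r ^ 2) * g r \<partial>lborel)"

abbreviation Gauss_integrable :: "complex \<Rightarrow> (real \<Rightarrow> complex) \<Rightarrow> bool" where
  "Gauss_integrable x g \<equiv> integrable lborel (\<lambda>r::real. exp (- (4 * x) * of_real r ^ 2) * g r)"

text \<open>
The only analytic input of Laplace's method: in the sector the weight has modulus at most
\<open>exp (- 2 |x| r\<^sup>2)\<close>. One half of this exponent absorbs \<open>exp (D q)\<close>, at the price of the constant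
\<open>exp (D\<^sup>2 / 4)\<close>; the other half is a Gaussian whose integral cancels the normalisation.
\<close>

lemma Gauss_mean_bound:
  fixes x :: complex and g :: "real \<Rightarrow> complex"
  assumes x0: "x \<noteq> 0" and x: "\<bar>Arg x\<bar> < pi / 4" and cont: "continuous_on UNIV g"
    and bound: "\<And>r. norm (g r) \<le> A * exp (D * (sqrt (norm x) * \<bar>r\<bar>))"
  shows "Gauss_integrable x g" "norm (Gauss_mean x g) \<le> 2 * A * exp (D\<^sup>2 / 4)"
proof -
  define m where "m = norm x"
  have m: "m > 0" using x0 by (simp add: m_def)
  have A: "A \<ge> 0" using order_trans[OF norm_ge_zero bound[of 0]] by simp
  have pt: "norm (exp (- (4 * x) * of_real r ^ 2) * g r) \<le> A * exp (D\<^sup>2 / 4) * exp (- m * r\<^sup>2)" for r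
  proof -
    define q where "q = sqrt m * \<bar>r\<bar>"
    have q2: "q\<^sup>2 = m * r\<^sup>2" using m by (simp add: q_def power_mult_distrib)
    have "Re (- (4 * x) * of_real r ^ 2) = - 4 * Re x * r\<^sup>2"
      by (simp flip: of_real_power)
    also have "\<dots> \<le> - 2 * q\<^sup>2"
      using mult_right_mono[OF Re_ge_half_norm[OF x], of "2 * r\<^sup>2"] unfolding q2 m_def by simp
    finally have "norm (exp (- (4 * x) * of_real r ^ 2)) \<le> exp (- 2 * q\<^sup>2)" by simp
    then have "norm (exp (- (4 * x) * of_real r ^ 2) * g r) \<le> exp (- 2 * q\<^sup>2) * (A * exp (D * q))"
      unfolding norm_mult using bound[of r] by (intro mult_mono) (auto simp: q_def m_def)
    also have "\<dots> = A * exp (D * q - 2 * q\<^sup>2)" by (simp add: exp_diff exp_minus divide_inverse)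
    also have "\<dots> \<le> A * exp (D\<^sup>2 / 4 + - m * r\<^sup>2)"
    proof -
      have "(q - D / 2)\<^sup>2 \<ge> 0" by simp
      then have "D * q - 2 * q\<^sup>2 \<le> D\<^sup>2 / 4 + - m * r\<^sup>2"
        by (simp add: power2_diff power_divide mult.commute flip: q2)
      then show ?thesis using A by (intro mult_left_mono) auto
    qed
    finally show ?thesis by (simp only: exp_add mult.assoc)
  qed
  note G = has_bochner_integral_Gaussian[OF m]
  have Gi: "integrable lborel (\<lambda>r. A * exp (D\<^sup>2 / 4) * exp (- m * r\<^sup>2))"
    using G by (intro integrable_mult_right) (simp add: has_bochner_integral_iff)
  show int: "Gauss_integrable x g"
  proof (rule Bochner_Integration.integrable_bound[OF Gi])
    show "(\<lambda>r. exp (- (4 * x) * of_real r ^ 2) * g r) \<in> borel_measurable lborel"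
      by (auto intro!: borel_measurable_continuous_onI continuous_intros cont)
    show "AE r in lborel. norm (exp (- (4 * x) * of_real r ^ 2) * g r) \<le> norm (A * exp (D\<^sup>2 / 4) * exp (- m * r\<^sup>2))"
      using A pt by (intro AE_I2) (simp add: abs_mult)
  qed
  have "norm (\<integral>r. exp (- (4 * x) * of_real r ^ 2) * g r \<partial>lborel) \<le> (\<integral>r. A * exp (D\<^sup>2 / 4) * exp (- m * r\<^sup>2) \<partial>lborel)"
    by (rule Bochner_Integration.integral_norm_bound_integral[OF int Gi]) (rule pt)
  also have "\<dots> = A * exp (D\<^sup>2 / 4) * sqrt (pi / m)"
    using has_bochner_integral_integral_eq[OF G] by simp
  finally have "norm (Gauss_mean x g) \<le> (2 * sqrt m / sqrt pi) * (A * exp (D\<^sup>2 / 4) * sqrt (pi / m))"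
    unfolding Gauss_mean_def norm_mult norm_divide m_def[symmetric]
    by (intro mult_mono) (auto simp: m_def)
  also have "\<dots> = 2 * A * exp (D\<^sup>2 / 4)" using m by (simp add: real_sqrt_divide)
  finally show "norm (Gauss_mean x g) \<le> 2 * A * exp (D\<^sup>2 / 4)" .
qed

lemma csqrt_4: "csqrt (4 * x) = 2 * csqrt x"
proof (rule csqrt_unique)
  show "0 < Re (2 * csqrt x) \<or> Re (2 * csqrt x) = 0 \<and> 0 \<le> Im (2 * csqrt x)"
    using csqrt_principal[of x] by auto
qed (simp add: power_mult_distrib)

lemma Gauss_moment:
  fixes x w :: complex
  assumes x: "Re x > 0"
  shows "Gauss_integrable x (\<lambda>r. cos (2 * w * csqrt x * of_real r) * of_real r ^ (2 * k))"
    and "Gauss_mean x (\<lambda>r. cos (2 * w * csqrt x * of_real r) * of_real r ^ (2 * k)) =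
      Gamma (of_nat k + 1/2) * hyp1F1 (of_nat k + 1/2) (1/2) (- (w ^ 2) / 4) / (of_real (sqrt pi) * (4 * x) ^ k)"
proof -
  have "has_bochner_integral lborel
     (\<lambda>r::real. exp (- (4 * x) * of_real r ^ 2) * cos (w * csqrt (4 * x) * of_real r) * of_real r ^ (2 * k))
     (Gamma (of_nat k + 1/2) * hyp1F1 (of_nat k + 1/2) (1/2) (- (w ^ 2) / 4) / ((4 * x) ^ k * csqrt (4 * x)))"
    by (rule Gaussian_cos_moment) (use x in simp)
  then have hb: "has_bochner_integral lborel
     (\<lambda>r::real. exp (- (4 * x) * of_real r ^ 2) * (cos (2 * w * csqrt x * of_real r) * of_real r ^ (2 * k)))
     (Gamma (of_nat k + 1/2) * hyp1F1 (of_nat k + 1/2) (1/2) (- (w ^ 2) / 4) / ((4 * x) ^ k * (2 * csqrt x)))"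
    unfolding csqrt_4 by (simp only: mult_ac)
  then show "Gauss_integrable x (\<lambda>r. cos (2 * w * csqrt x * of_real r) * of_real r ^ (2 * k))"
    by (simp only: has_bochner_integral_iff)
  have "x \<noteq> 0" using x by auto
  then show "Gauss_mean x (\<lambda>r. cos (2 * w * csqrt x * of_real r) * of_real r ^ (2 * k)) =
      Gamma (of_nat k + 1/2) * hyp1F1 (of_nat k + 1/2) (1/2) (- (w ^ 2) / 4) / (of_real (sqrt pi) * (4 * x) ^ k)"
    unfolding Gauss_mean_def has_bochner_integral_integral_eq[OF hb] by (simp add: field_simps)
qed

lemma Gamma_three_halves: "Gamma (3/2 :: complex) = of_real (sqrt pi) / 2"
  using Gamma_plus_of_nat[of "1/2" 1] Gamma_one_half_complex by simp

lemma Gamma_five_halves: "Gamma (5/2 :: complex) = 3 * of_real (sqrt pi) / 4"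
  using Gamma_plus_of_nat[of "3/2" 1] Gamma_three_halves by simp

lemma Gauss_mean_values:
  fixes x w :: complex
  assumes x: "Re x > 0"
  shows "Gauss_integrable x (\<lambda>r. 1)" "Gauss_mean x (\<lambda>r. 1) = 1"
    and "Gauss_integrable x (\<lambda>r. of_real r ^ 2)" "Gauss_mean x (\<lambda>r. of_real r ^ 2) = 1 / (8 * x)"
    and "Gauss_integrable x (\<lambda>r. of_real r ^ 4)" "Gauss_mean x (\<lambda>r. of_real r ^ 4) = 3 / (64 * x ^ 2)"
    and "Gauss_integrable x (\<lambda>r. cos (2 * w * csqrt x * of_real r))"
        "Gauss_mean x (\<lambda>r. cos (2 * w * csqrt x * of_real r)) = exp (- (w ^ 2) / 4)"
    and "Gauss_integrable x (\<lambda>r. of_real r ^ 2 * cos (2 * w * csqrt x * of_real r))"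
        "Gauss_mean x (\<lambda>r. of_real r ^ 2 * cos (2 * w * csqrt x * of_real r)) = (2 - w ^ 2) / (16 * x) * exp (- (w ^ 2) / 4)"
proof -
  have x0: "x \<noteq> 0" using x by auto
  have half: "hyp1F1 (1/2) (1/2) u = exp u" for u
    by (rule hyp1F1_self) (rule pochhammer_half_nonzero)
  have at0: "hyp1F1 a b 0 = 1" for a b
  proof -
    have "hyp1F1 a b 0 = (\<Sum>n\<in>{0}. pochhammer a n * 0 ^ n / (pochhammer b n * fact n))"
      unfolding hyp1F1_def by (rule suminf_finite) (auto simp: power_0_left)
    then show ?thesis by simp
  qed
  note g = Gamma_one_half_complex Gamma_three_halves Gamma_five_halves half at0 hyp1F1_three_halves
  show "Gauss_integrable x (\<lambda>r. 1)" "Gauss_mean x (\<lambda>r. 1) = 1"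
    using Gauss_moment[OF x, of 0 0] by (simp_all add: g)
  show "Gauss_integrable x (\<lambda>r. of_real r ^ 2)" "Gauss_mean x (\<lambda>r. of_real r ^ 2) = 1 / (8 * x)"
    using Gauss_moment[OF x, of 0 1] by (simp_all add: g)
  show "Gauss_integrable x (\<lambda>r. of_real r ^ 4)" "Gauss_mean x (\<lambda>r. of_real r ^ 4) = 3 / (64 * x ^ 2)"
    using Gauss_moment[OF x, of 0 2] by (simp_all add: g power_mult_distrib)
  show "Gauss_integrable x (\<lambda>r. cos (2 * w * csqrt x * of_real r))"
        "Gauss_mean x (\<lambda>r. cos (2 * w * csqrt x * of_real r)) = exp (- (w ^ 2) / 4)"
    using Gauss_moment[OF x, of w 0] by (simp_all add: g)
  show "Gauss_integrable x (\<lambda>r. of_real r ^ 2 * cos (2 * w * csqrt x * of_real r))"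
    using Gauss_moment(1)[OF x, of w 1] by (simp add: mult_ac)
  show "Gauss_mean x (\<lambda>r. of_real r ^ 2 * cos (2 * w * csqrt x * of_real r)) = (2 - w ^ 2) / (16 * x) * exp (- (w ^ 2) / 4)"
  proof -
    have "(\<lambda>r. of_real r ^ 2 * cos (2 * w * csqrt x * of_real r)) =
        (\<lambda>r. cos (2 * w * csqrt x * of_real r) * of_real r ^ (2 * 1))"
      by (simp add: mult.commute)
    then show ?thesis
      using x0 by (simp only: Gauss_moment(2)[OF x, of w 1]) (simp add: g field_simps)
  qed
qed

lemma Gauss_mean_diff:
  assumes "Gauss_integrable x f" "Gauss_integrable x g"
  shows "Gauss_mean x (\<lambda>r. f r - g r) = Gauss_mean x f - Gauss_mean x g"
  using assms by (simp add: Gauss_mean_def right_diff_distrib)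

lemma Gauss_mean_add:
  assumes "Gauss_integrable x f" "Gauss_integrable x g"
  shows "Gauss_integrable x (\<lambda>r. f r + g r)" "Gauss_mean x (\<lambda>r. f r + g r) = Gauss_mean x f + Gauss_mean x g"
  using assms by (simp_all add: Gauss_mean_def distrib_left)

lemma Gauss_mean_cmult:
  assumes "Gauss_integrable x f"
  shows "Gauss_integrable x (\<lambda>r. k * f r)" "Gauss_mean x (\<lambda>r. k * f r) = k * Gauss_mean x f"
proof -
  have e: "exp (- (4 * x) * of_real r ^ 2) * (k * f r) = k * (exp (- (4 * x) * of_real r ^ 2) * f r)" for r
    by (simp only: mult_ac)
  show "Gauss_integrable x (\<lambda>r. k * f r)" unfolding e using assms by (rule integrable_mult_right)
  show "Gauss_mean x (\<lambda>r. k * f r) = k * Gauss_mean x f"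
    unfolding Gauss_mean_def e integral_mult_right_zero by (simp only: mult_ac)
qed

section \<open>Elementary estimates for the integrand\<close>

lemma sin_cos_Taylor:
  fixes X :: complex
  shows "norm (cos X) \<le> exp (norm X)"
    and "norm (cos X - 1) \<le> norm X ^ 2 * exp (norm X)"
    and "norm (cos X - 1 + X\<^sup>2 / 2) \<le> norm X ^ 4 * exp (norm X)"
    and "norm (sin X) \<le> norm X * exp (norm X)"
    and "norm (sin X - X) \<le> norm X ^ 3 * exp (norm X)"
proof -
  have e: "exp \<bar>Im X\<bar> \<le> exp (norm X)" using abs_Im_le_cmod[of X] by simp
  have b: "exp \<bar>Im X\<bar> * norm X ^ k / fact j \<le> norm X ^ k * exp (norm X)" for k j
  proof -
    have "exp \<bar>Im X\<bar> * norm X ^ k / fact j \<le> exp \<bar>Im X\<bar> * norm X ^ k / 1"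
      by (intro divide_left_mono) (auto simp: fact_ge_1)
    also have "\<dots> \<le> norm X ^ k * exp (norm X)" using mult_left_mono[OF e, of "norm X ^ k"] by (simp add: mult.commute)
    finally show ?thesis .
  qed
  show "norm (cos X) \<le> exp (norm X)" by (rule norm_cos_le)
  show "norm (cos X - 1) \<le> norm X ^ 2 * exp (norm X)"
    using order_trans[OF Taylor_cos[of X 1] b] by (simp add: cos_coeff_def numeral_2_eq_2)
  have set3: "{..3::nat} = {0, 1, 2, 3}" and set2: "{..2::nat} = {0, 1, 2}" by auto
  have s3: "(\<Sum>k\<le>3. complex_of_real (cos_coeff k) * X ^ k) = 1 - X\<^sup>2 / 2"
    unfolding set3 by (simp add: cos_coeff_def)
  show "norm (cos X - 1 + X\<^sup>2 / 2) \<le> norm X ^ 4 * exp (norm X)"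
    using order_trans[OF Taylor_cos[of X 3] b[of "Suc 3" 3]] unfolding s3 by (simp add: algebra_simps)
  show "norm (sin X) \<le> norm X * exp (norm X)"
    using order_trans[OF Taylor_sin[of X 0] b[of "Suc 0" 0]] by simp
  have s2: "(\<Sum>k\<le>2. complex_of_real (sin_coeff k) * X ^ k) = X"
    unfolding set2 by (simp add: sin_coeff_def)
  show "norm (sin X - X) \<le> norm X ^ 3 * exp (norm X)"
    using order_trans[OF Taylor_sin[of X 2] b[of "Suc 2" 2]] unfolding s2 by (simp add: numeral_3_eq_3)
qed

text \<open>
All bounds come from the identity \<open>2 \<delta> + \<delta>\<^sup>2 = r\<^sup>2\<close>.
\<close>

lemma sqrt_one_plus_square:
  fixes r :: real
  defines "\<delta> \<equiv> sqrt (1 + r\<^sup>2) - 1"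
  shows "0 \<le> \<delta>" "\<delta> \<le> \<bar>r\<bar>" "\<delta> \<le> r\<^sup>2 / 2" "\<bar>\<delta> - r\<^sup>2 / 2\<bar> \<le> \<bar>r\<bar> ^ 4 / 8"
proof -
  show d0: "0 \<le> \<delta>" by (simp add: \<delta>_def)
  have "(1 + \<delta>)\<^sup>2 = 1 + r\<^sup>2" by (simp add: \<delta>_def)
  then have eq: "2 * \<delta> + \<delta>\<^sup>2 = r\<^sup>2" by (simp add: power2_eq_square algebra_simps)
  show "\<delta> \<le> \<bar>r\<bar>"
    by (rule power2_le_imp_le) (use eq d0 in auto)
  show d2: "\<delta> \<le> r\<^sup>2 / 2" using eq zero_le_power2[of \<delta>] by linarith
  have "\<delta>\<^sup>2 \<le> (r\<^sup>2 / 2)\<^sup>2" using d0 d2 by (intro power_mono) auto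
  moreover have "(r\<^sup>2 / 2)\<^sup>2 = \<bar>r\<bar> ^ 4 / 4" by (simp add: power_divide)
  ultimately show "\<bar>\<delta> - r\<^sup>2 / 2\<bar> \<le> \<bar>r\<bar> ^ 4 / 8" using eq zero_le_power2[of \<delta>] by linarith
qed

lemma inverse_sqrt_one_plus_square:
  fixes r :: real
  defines "\<kappa> \<equiv> 1 / sqrt (1 + r\<^sup>2)"
  shows "0 < \<kappa>" "\<kappa> \<le> 1" "\<bar>\<kappa> - 1\<bar> \<le> r\<^sup>2 / 2" "\<bar>\<kappa> - 1 + r\<^sup>2 / 2\<bar> \<le> \<bar>r\<bar> ^ 4"
proof -
  define s where "s = sqrt (1 + r\<^sup>2)"
  have s1: "s \<ge> 1" by (simp add: s_def)
  have k: "\<kappa> = 1 / s" by (simp add: \<kappa>_def s_def)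
  have r2: "r\<^sup>2 = s\<^sup>2 - 1" by (simp add: s_def)
  have d: "s - 1 \<le> r\<^sup>2 / 2" using sqrt_one_plus_square(3)[of r] by (simp add: s_def)
  show "0 < \<kappa>" "\<kappa> \<le> 1" using s1 by (simp_all add: k)
  have "1 - \<kappa> = (s - 1) / s" using s1 by (simp add: k field_simps)
  also have "\<dots> \<le> (s - 1) / 1" using s1 by (intro divide_left_mono) auto
  finally show "\<bar>\<kappa> - 1\<bar> \<le> r\<^sup>2 / 2" using d \<open>\<kappa> \<le> 1\<close> by simp
  have "\<kappa> - 1 + r\<^sup>2 / 2 = (s - 1)\<^sup>2 * (s + 2) / (2 * s)"
    using s1 unfolding k r2 by (simp add: field_simps power2_eq_square)
  moreover have "(s - 1)\<^sup>2 * (s + 2) / (2 * s) \<le> (s - 1)\<^sup>2 * 4"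
  proof -
    have "(s + 2) / (2 * s) \<le> 4" using s1 by (simp add: field_simps)
    from mult_left_mono[OF this, of "(s - 1)\<^sup>2"] show ?thesis by simp
  qed
  moreover have "(s - 1)\<^sup>2 \<le> (r\<^sup>2 / 2)\<^sup>2" using s1 d by (intro power_mono) auto
  moreover have "(r\<^sup>2 / 2)\<^sup>2 = \<bar>r\<bar> ^ 4 / 4" by (simp add: power_divide)
  moreover have "(s - 1)\<^sup>2 * (s + 2) / (2 * s) \<ge> 0" using s1 by simp
  ultimately show "\<bar>\<kappa> - 1 + r\<^sup>2 / 2\<bar> \<le> \<bar>r\<bar> ^ 4" by linarith
qed

text \<open>
The second bound needs \<open>t - t\<^sup>3 / 6 \<le> arsinh t\<close> for \<open>t \<ge> 0\<close>, which follows by integrating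
\<open>1 - t\<^sup>2 / 2 \<le> 1 / sqrt (1 + t\<^sup>2)\<close>.
\<close>

lemma arsinh_bounds:
  fixes r :: real
  shows "\<bar>arsinh r\<bar> \<le> \<bar>r\<bar>" "\<bar>(arsinh r)\<^sup>2 - r\<^sup>2\<bar> \<le> \<bar>r\<bar> ^ 4"
proof -
  have pos: "arsinh t \<le> t \<and> t - t ^ 3 / 6 \<le> arsinh t" if "t \<ge> 0" for t :: real
  proof -
    have der: "(arsinh has_real_derivative 1 / sqrt (1 + s\<^sup>2)) (at s)" for s :: real
      using arsinh_real_has_field_derivative[of s UNIV] by (simp add: add.commute)
    have cube: "((\<lambda>s. s ^ 3 / 6) has_real_derivative s\<^sup>2 / 2) (at s)" for s :: real
      by (auto intro!: derivative_eq_intros)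
    have up: "0 - arsinh 0 \<le> t - arsinh t"
    proof (rule DERIV_nonneg_imp_nondecreasing[OF that, of "\<lambda>s. s - arsinh s"])
      fix s :: real
      show "\<exists>y. ((\<lambda>s. s - arsinh s) has_real_derivative y) (at s) \<and> 0 \<le> y"
        using inverse_sqrt_one_plus_square(2)[of s] DERIV_diff[OF DERIV_ident der, of s]
        by (intro exI[of _ "1 - 1 / sqrt (1 + s\<^sup>2)"]) simp
    qed
    have lo: "arsinh 0 - (0 - 0 ^ 3 / 6) \<le> arsinh t - (t - t ^ 3 / 6)"
    proof (rule DERIV_nonneg_imp_nondecreasing[OF that, of "\<lambda>s. arsinh s - (s - s ^ 3 / 6)"])
      fix s :: real
      show "\<exists>y. ((\<lambda>s. arsinh s - (s - s ^ 3 / 6)) has_real_derivative y) (at s) \<and> 0 \<le> y"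
      proof (intro exI conjI)
        show "((\<lambda>s. arsinh s - (s - s ^ 3 / 6)) has_real_derivative (1 / sqrt (1 + s\<^sup>2) - (1 - s\<^sup>2 / 2))) (at s)"
          by (rule DERIV_diff[OF der DERIV_diff[OF DERIV_ident cube]])
        show "0 \<le> 1 / sqrt (1 + s\<^sup>2) - (1 - s\<^sup>2 / 2)"
          using inverse_sqrt_one_plus_square(3)[of s] by linarith
      qed
    qed
    show ?thesis using up lo by simp
  qed
  define t where "t = \<bar>r\<bar>"
  have t: "t \<ge> 0" by (simp add: t_def)
  have v: "\<bar>arsinh r\<bar> = arsinh t"
    by (cases "r \<ge> 0") (auto simp: t_def abs_if arsinh_real_neg_iff)
  have v0: "arsinh t \<ge> 0" using v by (metis abs_ge_zero)
  show "\<bar>arsinh r\<bar> \<le> \<bar>r\<bar>" using pos[OF t] v by (simp add: t_def)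
  have "t\<^sup>2 - (arsinh t)\<^sup>2 = (t - arsinh t) * (t + arsinh t)" by (simp add: power2_eq_square algebra_simps)
  also have "\<dots> \<le> (t ^ 3 / 6) * (2 * t)"
    using pos[OF t] t v0 by (intro mult_mono) auto
  also have "\<dots> \<le> t ^ 4" using t by (simp add: power3_eq_cube power4_eq_xxxx)
  finally have "t\<^sup>2 - (arsinh t)\<^sup>2 \<le> t ^ 4" .
  moreover have "(arsinh t)\<^sup>2 \<le> t\<^sup>2" using pos[OF t] v0 by (intro power_mono) auto
  moreover have "(arsinh r)\<^sup>2 = (arsinh t)\<^sup>2" using v by (metis power2_abs)
  moreover have "r\<^sup>2 = t\<^sup>2" by (simp add: t_def)
  ultimately have "\<bar>(arsinh r)\<^sup>2 - r\<^sup>2\<bar> \<le> t ^ 4" by linarith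
  then show "\<bar>(arsinh r)\<^sup>2 - r\<^sup>2\<bar> \<le> \<bar>r\<bar> ^ 4" unfolding t_def .
qed

text \<open>
Second and fourth order Taylor bounds with the single growth factor \<open>exp (2 B |r|)\<close>. The coefficient of
\<open>r\<^sup>2\<close> combines \<open>2z\<^sup>2\<close> from \<open>cosh\<close> with \<open>-1/2\<close> from \<open>1 / sqrt (1 + r\<^sup>2)\<close>.
\<close>

lemma cosh_weight_bounds:
  fixes z :: complex and r B :: real
  assumes B: "B \<ge> 1" "norm z \<le> B"
  defines "E \<equiv> exp (2 * B * \<bar>r\<bar>)"
  shows "norm (cosh_weight z r - 1) \<le> 5 * B ^ 2 * \<bar>r\<bar> ^ 2 * E"
    and "norm (cosh_weight z r - (1 + (2 * z\<^sup>2 - 1/2) * of_real r ^ 2)) \<le> 20 * B ^ 4 * \<bar>r\<bar> ^ 4 * E"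
proof -
  define v where "v = arsinh r"
  define \<kappa> where "\<kappa> = 1 / sqrt (1 + r\<^sup>2)"
  define X where "X = \<i> * (2 * z * of_real v)"
  note \<kappa> = inverse_sqrt_one_plus_square[of r, folded \<kappa>_def]
  have h: "cosh_weight z r = cos X * of_real \<kappa>"
    by (simp add: cosh_weight_def \<kappa>_def X_def v_def cosh_conv_cos)
  have v: "\<bar>v\<bar> \<le> \<bar>r\<bar>" unfolding v_def by (rule arsinh_bounds)
  have X: "norm X \<le> 2 * B * \<bar>r\<bar>"
    using B v by (simp add: X_def norm_mult mult_mono)
  have eX: "exp (norm X) \<le> E" using X by (simp add: E_def)
  have E1: "E \<ge> 1" using B by (simp add: E_def)
  have n\<kappa>: "norm (complex_of_real \<kappa>) \<le> 1" using \<kappa> by simp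
  have pX: "norm X ^ k * exp (norm X) \<le> (2 * B * \<bar>r\<bar>) ^ k * E" for k
    using X eX B by (intro mult_mono power_mono) auto
  have B24: "B ^ 2 \<le> B ^ 4" "1 \<le> B ^ 2" "1 \<le> B ^ 4" using B by (auto intro: power_increasing)
  have "cosh_weight z r - 1 = (cos X - 1) * of_real \<kappa> + of_real (\<kappa> - 1)"
    unfolding h by (simp add: algebra_simps)
  also have "norm \<dots> \<le> norm ((cos X - 1) * of_real \<kappa>) + norm (complex_of_real (\<kappa> - 1))"
    by (rule norm_triangle_ineq)
  also have "norm ((cos X - 1) * of_real \<kappa>) \<le> (2 * B * \<bar>r\<bar>) ^ 2 * E * 1"
    unfolding norm_mult by (intro mult_mono order_trans[OF sin_cos_Taylor(2) pX] n\<kappa>) (use E1 in auto)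
  also have "norm (complex_of_real (\<kappa> - 1)) \<le> \<bar>r\<bar> ^ 2 * 1"
    using \<kappa>(3) zero_le_power2[of r] unfolding norm_of_real power2_abs by linarith
  also have "\<bar>r\<bar> ^ 2 * 1 \<le> \<bar>r\<bar> ^ 2 * (B ^ 2 * E)"
    using B24 E1 by (intro mult_left_mono mult_ge1_I) auto
  finally show "norm (cosh_weight z r - 1) \<le> 5 * B ^ 2 * \<bar>r\<bar> ^ 2 * E"
    by (simp add: power_mult_distrib algebra_simps)
  have X2: "X\<^sup>2 = - 4 * z\<^sup>2 * of_real (v\<^sup>2)" by (simp add: X_def power_mult_distrib)
  have "cosh_weight z r - (1 + (2 * z\<^sup>2 - 1/2) * of_real r ^ 2) =
     (cos X - 1 + X\<^sup>2 / 2) * of_real \<kappa> + 2 * z\<^sup>2 * of_real ((v\<^sup>2 - r\<^sup>2) * \<kappa> + r\<^sup>2 * (\<kappa> - 1))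
     + of_real (\<kappa> - 1 + r\<^sup>2 / 2)"
    unfolding h X2 by (simp add: algebra_simps)
  also have "norm \<dots> \<le> norm ((cos X - 1 + X\<^sup>2 / 2) * of_real \<kappa>) +
     norm (2 * z\<^sup>2 * of_real ((v\<^sup>2 - r\<^sup>2) * \<kappa> + r\<^sup>2 * (\<kappa> - 1))) + norm (complex_of_real (\<kappa> - 1 + r\<^sup>2 / 2))"
    by (intro order_trans[OF norm_triangle_ineq] add_mono order_refl)
  also have "norm ((cos X - 1 + X\<^sup>2 / 2) * of_real \<kappa>) \<le> (2 * B * \<bar>r\<bar>) ^ 4 * E * 1"
    unfolding norm_mult by (intro mult_mono order_trans[OF sin_cos_Taylor(3) pX] n\<kappa>) (use E1 in auto)
  also have "norm (2 * z\<^sup>2 * of_real ((v\<^sup>2 - r\<^sup>2) * \<kappa> + r\<^sup>2 * (\<kappa> - 1))) \<le> (2 * B\<^sup>2) * (3/2 * \<bar>r\<bar> ^ 4)"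
  proof -
    have "\<bar>(v\<^sup>2 - r\<^sup>2) * \<kappa>\<bar> \<le> \<bar>r\<bar> ^ 4 * 1"
      unfolding abs_mult using arsinh_bounds(2)[of r] \<kappa> by (intro mult_mono) (auto simp: v_def)
    moreover have "\<bar>r\<^sup>2 * (\<kappa> - 1)\<bar> \<le> r\<^sup>2 * (r\<^sup>2 / 2)"
      unfolding abs_mult using \<kappa> by (intro mult_mono) auto
    moreover have "r\<^sup>2 * (r\<^sup>2 / 2) = \<bar>r\<bar> ^ 4 / 2" by (simp add: power4_eq_xxxx power2_eq_square)
    ultimately have "\<bar>(v\<^sup>2 - r\<^sup>2) * \<kappa> + r\<^sup>2 * (\<kappa> - 1)\<bar> \<le> 3/2 * \<bar>r\<bar> ^ 4" by linarith
    then show ?thesis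
      unfolding norm_mult norm_of_real norm_power using B by (intro mult_mono power_mono) auto
  qed
  also have "norm (complex_of_real (\<kappa> - 1 + r\<^sup>2 / 2)) \<le> \<bar>r\<bar> ^ 4"
    using \<kappa>(4) unfolding norm_of_real .
  also have "(2 * B * \<bar>r\<bar>) ^ 4 * E * 1 + 2 * B\<^sup>2 * (3/2 * \<bar>r\<bar> ^ 4) + \<bar>r\<bar> ^ 4 \<le>
     16 * B ^ 4 * \<bar>r\<bar> ^ 4 * E + 3 * (B ^ 4 * \<bar>r\<bar> ^ 4 * E) + B ^ 4 * \<bar>r\<bar> ^ 4 * E"
  proof -
    have "\<bar>r\<bar> ^ 4 * B\<^sup>2 \<le> \<bar>r\<bar> ^ 4 * (B ^ 4 * E)"
      using B24 E1 by (intro mult_left_mono order_trans[OF B24(1)] mult_le_cancel_left1[THEN iffD2]) auto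
    moreover have "\<bar>r\<bar> ^ 4 * 1 \<le> \<bar>r\<bar> ^ 4 * (B ^ 4 * E)"
      using B24 E1 by (intro mult_left_mono mult_ge1_I) auto
    ultimately show ?thesis by (simp add: power_mult_distrib mult_ac)
  qed
  finally show "norm (cosh_weight z r - (1 + (2 * z\<^sup>2 - 1/2) * of_real r ^ 2)) \<le> 20 * B ^ 4 * \<bar>r\<bar> ^ 4 * E"
    by (simp add: mult_ac)
qed

section \<open>Expansion of the three integrands\<close>

text \<open>
Lets every error term \<open>B\<^sup>j q\<^sup>k exp (s q)\<close> of the expansions be bounded by one common quantity.
\<close>

lemma absorb_polynomial:
  fixes B q s :: real
  assumes "B \<ge> 1" "q \<ge> 0" "j \<le> 6" "k \<le> 10" "s \<le> 4 * B"
  shows "B ^ j * q ^ k * exp (s * q) \<le> B ^ 6 * exp ((4 * B + 10) * q)"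
proof -
  have "q \<le> exp q" using exp_ge_add_one_self[of q] by linarith
  then have "q ^ k \<le> exp q ^ k" using assms by (intro power_mono) auto
  also have "\<dots> = exp (real k * q)" by (rule exp_of_nat_mult[symmetric])
  also have "\<dots> \<le> exp (10 * q)" using assms by (simp add: mult_right_mono)
  finally have "q ^ k \<le> exp (10 * q)" .
  moreover have "exp (s * q) \<le> exp (4 * B * q)" using assms by (simp add: mult_right_mono)
  ultimately have "B ^ j * q ^ k * exp (s * q) \<le> B ^ 6 * exp (10 * q) * exp (4 * B * q)"
    using assms by (intro mult_mono power_increasing) auto
  also have "\<dots> = B ^ 6 * exp ((4 * B + 10) * q)"
    by (simp add: distrib_right exp_add)
  finally show ?thesis .
qed

text \<open>
The phase \<open>X = 2 w (sqrt x) \<delta>\<close> in the Gaussian scale \<open>q\<close>. The bound \<open>2 B q\<close> controls exponentials of \<open>|X|\<close>,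
while the bound \<open>B q\<^sup>2 / T\<close> supplies the negative powers of \<open>T\<close>, a square root of \<open>|x|\<close>.
\<close>

lemma phase_bounds:
  fixes x w :: complex and r B :: real
  assumes B: "B \<ge> 1" "norm w \<le> B" and x: "norm x \<ge> 1"
  defines "T \<equiv> sqrt (norm x)"
  defines "q \<equiv> T * \<bar>r\<bar>" and "\<delta> \<equiv> sqrt (1 + r\<^sup>2) - 1"
  shows "norm (2 * w * csqrt x * of_real \<delta>) \<le> 2 * B * q"
    and "norm (2 * w * csqrt x * of_real \<delta>) \<le> B * q ^ 2 / T"
    and "norm (2 * w * csqrt x * of_real r) \<le> 2 * B * q"
    and "norm (2 * w * csqrt x * of_real \<delta> - w * csqrt x * of_real r ^ 2) \<le> B * q ^ 4 / T ^ 3"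
    and "norm ((2 * w * csqrt x * of_real \<delta>)\<^sup>2 / 2 - w\<^sup>2 * x / 2 * of_real r ^ 4) \<le> B ^ 2 * q ^ 6 / T ^ 4"
    and "\<bar>r\<bar> = q / T" "\<bar>r\<bar> \<le> q" "0 \<le> q"
proof -
  note d = sqrt_one_plus_square[of r, folded \<delta>_def]
  have T: "1 \<le> T" using x by (simp add: T_def)
  have T0: "T > 0" using T by linarith
  show q0: "0 \<le> q" using T0 by (simp add: q_def)
  show rq: "\<bar>r\<bar> = q / T" using T0 by (simp add: q_def)
  show rq': "\<bar>r\<bar> \<le> q" using T mult_right_mono[of 1 T "\<bar>r\<bar>"] by (simp add: q_def)
  have n: "norm (w * csqrt x) \<le> B * T"
    unfolding norm_mult norm_csqrt T_def using B by (intro mult_right_mono) auto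
  have nt: "norm (w * csqrt x * of_real t) \<le> B * T * \<bar>t\<bar>" for t
    unfolding norm_mult[of "w * csqrt x"] norm_of_real by (intro mult_right_mono n) auto
  have nt': "norm (2 * w * csqrt x * of_real t) \<le> 2 * B * T * \<bar>t\<bar>" for t
    using nt[of t] by (simp add: norm_mult)
  have "2 * B * T * \<bar>\<delta>\<bar> \<le> 2 * B * T * \<bar>r\<bar>"
    using d B T0 by (intro mult_left_mono) auto
  then show 1: "norm (2 * w * csqrt x * of_real \<delta>) \<le> 2 * B * q"
    using nt'[of \<delta>] by (simp add: q_def mult.assoc)
  have "2 * B * T * \<bar>\<delta>\<bar> \<le> 2 * B * T * (\<bar>r\<bar>\<^sup>2 / 2)"
    using d B T0 by (intro mult_left_mono) auto
  also have "\<dots> = B * q ^ 2 / T" using T0 unfolding rq by (simp add: power_divide power2_eq_square)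
  finally show "norm (2 * w * csqrt x * of_real \<delta>) \<le> B * q ^ 2 / T"
    using nt'[of \<delta>] by linarith
  show "norm (2 * w * csqrt x * of_real r) \<le> 2 * B * q"
    using nt'[of r] by (simp add: q_def mult.assoc)
  have "2 * w * csqrt x * of_real \<delta> - w * csqrt x * of_real r ^ 2 = 2 * w * csqrt x * of_real (\<delta> - r\<^sup>2 / 2)"
    by (simp add: algebra_simps)
  then have "norm (2 * w * csqrt x * of_real \<delta> - w * csqrt x * of_real r ^ 2) \<le> 2 * B * T * \<bar>\<delta> - r\<^sup>2 / 2\<bar>"
    using nt'[of "\<delta> - r\<^sup>2 / 2"] by (simp only:)
  also have "\<dots> \<le> 2 * B * T * (\<bar>r\<bar> ^ 4 / 2)"
    using d(4) B T0 by (intro mult_left_mono order_trans[OF d(4)]) auto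
  also have "\<dots> = B * q ^ 4 / T ^ 3" using T0 unfolding rq
    by (simp add: power_divide power4_eq_xxxx power3_eq_cube)
  finally show "norm (2 * w * csqrt x * of_real \<delta> - w * csqrt x * of_real r ^ 2) \<le> B * q ^ 4 / T ^ 3" .
  have "(2 * w * csqrt x * of_real \<delta>)\<^sup>2 / 2 - w\<^sup>2 * x / 2 * of_real r ^ 4 =
     2 * (w * csqrt x)\<^sup>2 * of_real ((\<delta> - r\<^sup>2 / 2) * (\<delta> + r\<^sup>2 / 2))"
    by (simp add: power_mult_distrib algebra_simps power2_eq_square[of "complex_of_real _"] power4_eq_xxxx)
  also have "norm \<dots> \<le> 2 * (B * T)\<^sup>2 * (\<bar>r\<bar> ^ 4 / 8 * \<bar>r\<bar> ^ 2)"
  proof -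
    have "\<bar>(\<delta> - r\<^sup>2 / 2) * (\<delta> + r\<^sup>2 / 2)\<bar> \<le> \<bar>r\<bar> ^ 4 / 8 * \<bar>r\<bar> ^ 2"
      unfolding abs_mult using d by (intro mult_mono) auto
    then show ?thesis
      using power_mono[OF n norm_ge_zero, of 2]
      unfolding norm_mult[of "2 * (w * csqrt x)\<^sup>2"] norm_of_real norm_mult[of 2] norm_power
      by (intro mult_mono) auto
  qed
  also have "\<dots> = B ^ 2 * q ^ 6 / T ^ 4 / 4" using T0 unfolding rq
    by (simp add: power_divide power_mult_distrib field_simps flip: power_add)
  also have "\<dots> \<le> B ^ 2 * q ^ 6 / T ^ 4"
  proof -
    have "0 \<le> B ^ 2 * q ^ 6 / T ^ 4" using q0 T0 by simp
    moreover have "y / 4 \<le> y" if "0 \<le> y" for y :: real using that by simp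
    ultimately show ?thesis by blast
  qed
  finally show "norm ((2 * w * csqrt x * of_real \<delta>)\<^sup>2 / 2 - w\<^sup>2 * x / 2 * of_real r ^ 4) \<le> B ^ 2 * q ^ 6 / T ^ 4" .
qed

text \<open>
With \<open>\<alpha> = 2z\<^sup>2 - 1/2\<close> and \<open>\<beta> = w\<^sup>2x/2\<close> the error is
\<open>(h - (1 + \<alpha>r\<^sup>2)) cos X + (1 + \<alpha>r\<^sup>2) (cos X - 1 + \<beta>r\<^sup>4) - \<alpha>\<beta>r\<^sup>6\<close>. Although \<open>\<beta>\<close> grows like \<open>|x|\<close>, the term
\<open>\<beta>r\<^sup>4\<close> is of order \<open>1/|x|\<close> in the Gaussian scale, and all three error terms are of order \<open>1/|x|\<^sup>2\<close>.
\<close>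

lemma P_integrand_expansion:
  fixes x z w :: complex and r B :: real
  assumes B: "B \<ge> 1" "norm z \<le> B" "norm w \<le> B" and x: "norm x \<ge> 1"
  shows "norm (cosh_weight z r * cos (2 * w * csqrt x * of_real (sqrt (1 + r\<^sup>2) - 1))
      - (1 + (2 * z\<^sup>2 - 1/2) * of_real r ^ 2 - w\<^sup>2 * x / 2 * of_real r ^ 4))
    \<le> 30 * B ^ 6 / norm x ^ 2 * exp ((4 * B + 10) * (sqrt (norm x) * \<bar>r\<bar>))"
proof -
  define T where "T = sqrt (norm x)"
  define q where "q = T * \<bar>r\<bar>"
  define X where "X = 2 * w * csqrt x * of_real (sqrt (1 + r\<^sup>2) - 1)"
  define h where "h = cosh_weight z r"
  define \<alpha> where "\<alpha> = 2 * z\<^sup>2 - 1/2"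
  define \<beta> where "\<beta> = w\<^sup>2 * x / 2"
  note ph = phase_bounds[OF B(1,3) x, of r, folded T_def, folded q_def X_def \<beta>_def]
  have T0: "T > 0" unfolding T_def real_sqrt_gt_0_iff using x by linarith
  have T4: "T ^ 4 = norm x ^ 2" by (simp add: T_def power4_eq_xxxx power2_eq_square)
  define E where "E = exp (2 * B * q)"
  have E1: "E \<ge> 1" using B ph(8) by (simp add: E_def)
  define G where "G = B ^ 6 * exp ((4 * B + 10) * q)"
  have absorb: "B ^ j * q ^ k * exp (s * q) \<le> G" if "j \<le> 6" "k \<le> 10" "s \<le> 4 * B" for j k s
    unfolding G_def using that by (intro absorb_polynomial B ph) auto
  have \<alpha>: "norm \<alpha> \<le> 3 * B ^ 2"
  proof -
    have "norm \<alpha> \<le> norm (2 * z\<^sup>2) + norm (1/2 :: complex)" unfolding \<alpha>_def by (rule norm_triangle_ineq4)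
    moreover have "norm (2 * z\<^sup>2) \<le> 2 * B ^ 2"
      using power_mono[OF B(2) norm_ge_zero, of 2] by (simp add: norm_mult norm_power)
    moreover have "1 \<le> B ^ 2" using B by simp
    ultimately show ?thesis by simp
  qed
  have \<beta>: "norm \<beta> \<le> B ^ 2 * T ^ 2 / 2"
  proof -
    have "norm (w ^ 2) \<le> B ^ 2" using power_mono[OF B(3) norm_ge_zero, of 2] by (simp add: norm_power)
    moreover have "norm x = T ^ 2" by (simp add: T_def)
    ultimately show ?thesis by (simp add: \<beta>_def norm_mult mult_right_mono)
  qed
  have eX: "exp (norm X) \<le> E" using ph(1) by (simp add: E_def)
  have eh: "exp (2 * B * \<bar>r\<bar>) \<le> E" using ph(7) B by (simp add: E_def)
  have h1: "norm (h - (1 + \<alpha> * of_real r ^ 2)) \<le> 20 * B ^ 4 * (q / T) ^ 4 * E"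
  proof -
    have "norm (h - (1 + \<alpha> * of_real r ^ 2)) \<le> 20 * B ^ 4 * \<bar>r\<bar> ^ 4 * exp (2 * B * \<bar>r\<bar>)"
      unfolding h_def \<alpha>_def by (rule cosh_weight_bounds[OF B(1,2)])
    also have "\<dots> \<le> 20 * B ^ 4 * \<bar>r\<bar> ^ 4 * E" using B by (intro mult_left_mono eh) auto
    finally show ?thesis unfolding ph(6) .
  qed
  have 1: "norm ((h - (1 + \<alpha> * of_real r ^ 2)) * cos X) \<le> 20 * G / T ^ 4"
  proof -
    have "norm ((h - (1 + \<alpha> * of_real r ^ 2)) * cos X) \<le> (20 * B ^ 4 * (q / T) ^ 4 * E) * E"
      unfolding norm_mult by (intro mult_mono h1 order_trans[OF sin_cos_Taylor(1) eX]) (use B ph E1 T0 in auto)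
    also have "\<dots> = 20 * (B ^ 4 * q ^ 4 * exp (4 * B * q)) / T ^ 4"
      by (simp add: E_def power_divide flip: exp_add)
    also have "\<dots> \<le> 20 * G / T ^ 4"
      using T0 by (intro divide_right_mono mult_left_mono absorb) auto
    finally show ?thesis .
  qed
  have 2: "norm ((1 + \<alpha> * of_real r ^ 2) * (cos X - 1 + \<beta> * of_real r ^ 4)) \<le> 8 * G / T ^ 4"
  proof -
    have "cos X - 1 + \<beta> * of_real r ^ 4 = (cos X - 1 + X\<^sup>2 / 2) - (X\<^sup>2 / 2 - \<beta> * of_real r ^ 4)" by simp
    also have "norm \<dots> \<le> norm (cos X - 1 + X\<^sup>2 / 2) + norm (X\<^sup>2 / 2 - \<beta> * of_real r ^ 4)"
      by (rule norm_triangle_ineq4)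
    also have "\<dots> \<le> (B * q ^ 2 / T) ^ 4 * E + B ^ 2 * q ^ 6 / T ^ 4"
    proof (rule add_mono[OF _ ph(5)])
      have "norm X ^ 4 * exp (norm X) \<le> (B * q ^ 2 / T) ^ 4 * E"
        using ph(2) B ph(8) T0 by (intro mult_mono eX power_mono) auto
      then show "norm (cos X - 1 + X\<^sup>2 / 2) \<le> (B * q ^ 2 / T) ^ 4 * E"
        using sin_cos_Taylor(3)[of X] by linarith
    qed
    also have "\<dots> = (B ^ 4 * q ^ 8 * E + B ^ 2 * q ^ 6) / T ^ 4"
      by (simp add: power_divide power_mult_distrib add_divide_distrib flip: power_mult)
    finally have c: "norm (cos X - 1 + \<beta> * of_real r ^ 4) \<le> (B ^ 4 * q ^ 8 * E + B ^ 2 * q ^ 6) / T ^ 4" .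
    have "norm (1 + \<alpha> * of_real r ^ 2) \<le> 1 + 3 * B ^ 2 * q ^ 2"
    proof -
      have "norm (\<alpha> * of_real r ^ 2) \<le> 3 * B ^ 2 * q ^ 2"
        unfolding norm_mult norm_power norm_of_real
        by (intro mult_mono \<alpha> power_mono ph) auto
      then show ?thesis using norm_triangle_ineq[of 1 "\<alpha> * of_real r ^ 2"] by simp
    qed
    then have "norm ((1 + \<alpha> * of_real r ^ 2) * (cos X - 1 + \<beta> * of_real r ^ 4)) \<le>
       (1 + 3 * B ^ 2 * q ^ 2) * ((B ^ 4 * q ^ 8 * E + B ^ 2 * q ^ 6) / T ^ 4)"
      unfolding norm_mult[of "1 + \<alpha> * of_real r ^ 2"] using B ph(8) by (intro mult_mono c) auto
    also have "\<dots> = (B ^ 4 * q ^ 8 * exp (2 * B * q) + B ^ 2 * q ^ 6 * exp (0 * q) +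
        3 * (B ^ 6 * q ^ 10 * exp (2 * B * q)) + 3 * (B ^ 4 * q ^ 8 * exp (0 * q))) / T ^ 4"
      by (simp add: E_def algebra_simps flip: power_add)
    also have "\<dots> \<le> (G + G + 3 * G + 3 * G) / T ^ 4"
      using T0 B by (intro divide_right_mono add_mono mult_left_mono absorb) auto
    finally show ?thesis by simp
  qed
  have 3: "norm (\<alpha> * \<beta> * of_real r ^ 6) \<le> 2 * G / T ^ 4"
  proof -
    have "norm (\<alpha> * \<beta> * of_real r ^ 6) \<le> (3 * B ^ 2) * (B ^ 2 * T ^ 2 / 2) * (q / T) ^ 6"
      unfolding norm_mult norm_power norm_of_real ph(6)
      using T0 ph(8) by (intro mult_mono \<alpha> \<beta>) auto
    also have "\<dots> = 3/2 * (B ^ 4 * q ^ 6 * exp (0 * q)) / T ^ 4"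
      using T0 by (simp add: power_divide field_simps flip: power_add)
    also have "\<dots> \<le> 3/2 * G / T ^ 4"
      using T0 B by (intro divide_right_mono mult_left_mono absorb) auto
    also have "\<dots> \<le> 2 * G / T ^ 4"
      using T0 B by (intro divide_right_mono) (auto simp: G_def)
    finally show ?thesis .
  qed
  have "h * cos X - (1 + \<alpha> * of_real r ^ 2 - \<beta> * of_real r ^ 4) =
     (h - (1 + \<alpha> * of_real r ^ 2)) * cos X + (1 + \<alpha> * of_real r ^ 2) * (cos X - 1 + \<beta> * of_real r ^ 4)
     - \<alpha> * \<beta> * of_real r ^ 6"
    by (simp add: algebra_simps flip: power_add)
  also have "norm \<dots> \<le> 20 * G / T ^ 4 + 8 * G / T ^ 4 + 2 * G / T ^ 4"
    using 1 2 3 by (intro order_trans[OF norm_triangle_ineq4] add_mono order_trans[OF norm_triangle_ineq])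
  also have "\<dots> = 30 * B ^ 6 / norm x ^ 2 * exp ((4 * B + 10) * (sqrt (norm x) * \<bar>r\<bar>))"
    unfolding G_def T4 q_def unfolding T_def by (simp add: field_simps)
  finally show ?thesis unfolding h_def X_def \<alpha>_def \<beta>_def .
qed

text \<open>
The sine already is of order \<open>|x|\<^sup>-\<^sup>1\<^sup>/\<^sup>2\<close>, so \<open>h\<close> may be replaced by \<open>1\<close> and \<open>sin X\<close> by the leading part of \<open>X\<close>.
\<close>

lemma Q_integrand_expansion:
  fixes x z w :: complex and r B :: real
  assumes B: "B \<ge> 1" "norm z \<le> B" "norm w \<le> B" and x: "norm x \<ge> 1"
  shows "norm (cosh_weight z r * sin (2 * w * csqrt x * of_real (sqrt (1 + r\<^sup>2) - 1))
      - w * csqrt x * of_real r ^ 2)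
    \<le> 7 * B ^ 6 / sqrt (norm x) ^ 3 * exp ((4 * B + 10) * (sqrt (norm x) * \<bar>r\<bar>))"
proof -
  define T where "T = sqrt (norm x)"
  define q where "q = T * \<bar>r\<bar>"
  define X where "X = 2 * w * csqrt x * of_real (sqrt (1 + r\<^sup>2) - 1)"
  define h where "h = cosh_weight z r"
  note ph = phase_bounds[OF B(1,3) x, of r, folded T_def, folded q_def X_def]
  have T0: "T > 0" unfolding T_def real_sqrt_gt_0_iff using x by linarith
  define E where "E = exp (2 * B * q)"
  have E1: "E \<ge> 1" using B ph(8) by (simp add: E_def)
  define G where "G = B ^ 6 * exp ((4 * B + 10) * q)"
  have absorb: "B ^ j * q ^ k * exp (s * q) \<le> G" if "j \<le> 6" "k \<le> 10" "s \<le> 4 * B" for j k s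
    unfolding G_def using that by (intro absorb_polynomial B ph) auto
  have eX: "exp (norm X) \<le> E" using ph(1) by (simp add: E_def)
  have eh: "exp (2 * B * \<bar>r\<bar>) \<le> E" using ph(7) B by (simp add: E_def)
  have pX: "norm X ^ k * exp (norm X) \<le> (B * q ^ 2 / T) ^ k * E" for k
    using ph(2) B ph(8) T0 by (intro mult_mono eX power_mono) auto
  have 1: "norm ((h - 1) * sin X) \<le> 5 * G / T ^ 3"
  proof -
    have "norm (h - 1) \<le> 5 * B ^ 2 * \<bar>r\<bar> ^ 2 * exp (2 * B * \<bar>r\<bar>)"
      unfolding h_def by (rule cosh_weight_bounds[OF B(1,2)])
    also have "\<dots> \<le> 5 * B ^ 2 * \<bar>r\<bar> ^ 2 * E" using B by (intro mult_left_mono eh) auto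
    finally have "norm (h - 1) \<le> 5 * B ^ 2 * (q / T) ^ 2 * E" unfolding ph(6) .
    moreover have "norm (sin X) \<le> (B * q ^ 2 / T) * E"
      using order_trans[OF sin_cos_Taylor(4)[of X]] pX[of 1] by simp
    ultimately have "norm ((h - 1) * sin X) \<le> (5 * B ^ 2 * (q / T) ^ 2 * E) * ((B * q ^ 2 / T) * E)"
      unfolding norm_mult using E1 by (intro mult_mono) auto
    also have "\<dots> = 5 * (B ^ 3 * q ^ 4 * exp (4 * B * q)) / T ^ 3"
      by (simp add: E_def power_divide power2_eq_square power3_eq_cube power4_eq_xxxx flip: exp_add)
    also have "\<dots> \<le> 5 * G / T ^ 3"
      using T0 by (intro divide_right_mono mult_left_mono absorb) auto
    finally show ?thesis .
  qed
  have 2: "norm (sin X - X) \<le> G / T ^ 3"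
  proof -
    have "norm (sin X - X) \<le> (B * q ^ 2 / T) ^ 3 * E"
      by (rule order_trans[OF sin_cos_Taylor(5) pX])
    also have "\<dots> = (B ^ 3 * q ^ 6 * exp (2 * B * q)) / T ^ 3"
      by (simp add: E_def power_divide power_mult_distrib flip: power_mult)
    also have "\<dots> \<le> G / T ^ 3"
      using T0 B by (intro divide_right_mono absorb) auto
    finally show ?thesis .
  qed
  have 3: "norm (X - w * csqrt x * of_real r ^ 2) \<le> G / T ^ 3"
  proof -
    have "norm (X - w * csqrt x * of_real r ^ 2) \<le> B ^ 1 * q ^ 4 * exp (0 * q) / T ^ 3"
      using ph(4) by simp
    also have "\<dots> \<le> G / T ^ 3"
      using T0 B by (intro divide_right_mono absorb) auto
    finally show ?thesis .
  qed
  have "h * sin X - w * csqrt x * of_real r ^ 2 = (h - 1) * sin X + (sin X - X) + (X - w * csqrt x * of_real r ^ 2)"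
    by (simp add: algebra_simps)
  also have "norm \<dots> \<le> 5 * G / T ^ 3 + G / T ^ 3 + G / T ^ 3"
    using 1 2 3 by (intro order_trans[OF norm_triangle_ineq] add_mono)
  also have "\<dots> = 7 * B ^ 6 / sqrt (norm x) ^ 3 * exp ((4 * B + 10) * (sqrt (norm x) * \<bar>r\<bar>))"
    unfolding G_def q_def T_def by (simp add: field_simps)
  finally show ?thesis unfolding h_def X_def .
qed

text \<open>
Here the phase \<open>ur\<close> is of order one in the Gaussian scale, so the cosine has to stay in the model.
\<close>

lemma R_integrand_expansion:
  fixes x z w :: complex and r B :: real
  assumes B: "B \<ge> 1" "norm z \<le> B" "norm w \<le> B" and x: "norm x \<ge> 1"
  shows "norm (cosh_weight z r * cos (2 * w * csqrt x * of_real r)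
      - (1 + (2 * z\<^sup>2 - 1/2) * of_real r ^ 2) * cos (2 * w * csqrt x * of_real r))
    \<le> 20 * B ^ 6 / norm x ^ 2 * exp ((4 * B + 10) * (sqrt (norm x) * \<bar>r\<bar>))"
proof -
  define T where "T = sqrt (norm x)"
  define q where "q = T * \<bar>r\<bar>"
  define X where "X = 2 * w * csqrt x * of_real r"
  note ph = phase_bounds[OF B(1,3) x, of r, folded T_def, folded q_def X_def]
  have T0: "T > 0" unfolding T_def real_sqrt_gt_0_iff using x by linarith
  have T4: "T ^ 4 = norm x ^ 2" by (simp add: T_def power4_eq_xxxx power2_eq_square)
  define E where "E = exp (2 * B * q)"
  have E1: "E \<ge> 1" using B ph(8) by (simp add: E_def)
  have eX: "exp (norm X) \<le> E" using ph(3) by (simp add: E_def)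
  have eh: "exp (2 * B * \<bar>r\<bar>) \<le> E" using ph(7) B by (simp add: E_def)
  have "norm (cosh_weight z r - (1 + (2 * z\<^sup>2 - 1/2) * of_real r ^ 2)) \<le> 20 * B ^ 4 * \<bar>r\<bar> ^ 4 * exp (2 * B * \<bar>r\<bar>)"
    by (rule cosh_weight_bounds[OF B(1,2)])
  also have "\<dots> \<le> 20 * B ^ 4 * \<bar>r\<bar> ^ 4 * E" using B by (intro mult_left_mono eh) auto
  finally have "norm (cosh_weight z r - (1 + (2 * z\<^sup>2 - 1/2) * of_real r ^ 2)) \<le> 20 * B ^ 4 * (q / T) ^ 4 * E"
    unfolding ph(6) .
  then have "norm ((cosh_weight z r - (1 + (2 * z\<^sup>2 - 1/2) * of_real r ^ 2)) * cos X) \<le> (20 * B ^ 4 * (q / T) ^ 4 * E) * E"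
    unfolding norm_mult by (intro mult_mono order_trans[OF sin_cos_Taylor(1) eX]) (use B ph E1 T0 in auto)
  also have "\<dots> = 20 * (B ^ 4 * q ^ 4 * exp (4 * B * q)) / T ^ 4"
    by (simp add: E_def power_divide flip: exp_add)
  also have "\<dots> \<le> 20 * (B ^ 6 * exp ((4 * B + 10) * q)) / T ^ 4"
    using T0 B ph by (intro divide_right_mono mult_left_mono absorb_polynomial) auto
  also have "\<dots> = 20 * B ^ 6 / norm x ^ 2 * exp ((4 * B + 10) * (sqrt (norm x) * \<bar>r\<bar>))"
    unfolding T4 q_def unfolding T_def by simp
  finally show ?thesis unfolding X_def by (simp only: left_diff_distrib)
qed

section \<open>The asymptotic expansion\<close>

text \<open>
The factor \<open>exp (w\<^sup>2 / 4)\<close> in the third function offsets the mean \<open>exp (- w\<^sup>2 / 4)\<close> of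
\<open>cos (2 w (sqrt x) r)\<close>, so that all three functions have the normalisation of the theorem.
\<close>

definition P_coeff :: "complex \<Rightarrow> complex \<Rightarrow> complex \<Rightarrow> complex" where
  "P_coeff x z w = Gauss_mean x (\<lambda>r. cosh_weight z r * cos (2 * w * csqrt x * of_real (sqrt (1 + r\<^sup>2) - 1)))"

definition Q_coeff :: "complex \<Rightarrow> complex \<Rightarrow> complex \<Rightarrow> complex" where
  "Q_coeff x z w = Gauss_mean x (\<lambda>r. cosh_weight z r * sin (2 * w * csqrt x * of_real (sqrt (1 + r\<^sup>2) - 1)))"

definition R_coeff :: "complex \<Rightarrow> complex \<Rightarrow> complex \<Rightarrow> complex" where
  "R_coeff x z w = exp (w\<^sup>2 / 4) * Gauss_mean x (\<lambda>r. cosh_weight z r * cos (2 * w * csqrt x * of_real r))"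

lemma Gauss_mean_approx:
  assumes x: "norm x \<ge> 1" "\<bar>Arg x\<bar> < pi / 4"
    and cont: "continuous_on UNIV f" "continuous_on UNIV g" and g: "Gauss_integrable x g"
    and bound: "\<And>r. norm (f r - g r) \<le> A * exp (D * (sqrt (norm x) * \<bar>r\<bar>))"
  shows "Gauss_integrable x f" "norm (Gauss_mean x f - Gauss_mean x g) \<le> 2 * A * exp (D\<^sup>2 / 4)"
proof -
  have x0: "x \<noteq> 0" using x by auto
  note b = Gauss_mean_bound[OF x0 x(2) continuous_on_diff[OF cont] bound]
  show i: "Gauss_integrable x f"
    using Gauss_mean_add(1)[OF b(1) g] by simp
  show "norm (Gauss_mean x f - Gauss_mean x g) \<le> 2 * A * exp (D\<^sup>2 / 4)"
    using b(2) unfolding Gauss_mean_diff[OF i g] .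
qed

text \<open>
Each integrand is compared with its model. One constant \<open>C\<close> serves for all three estimates; its last
factor bounds \<open>exp (w\<^sup>2 / 4)\<close>, which occurs in \<open>R_coeff\<close> only.
\<close>

lemma coeff_expansions:
  fixes x z w :: complex and B :: real
  assumes B: "B \<ge> 1" "norm z \<le> B" "norm w \<le> B" and x: "norm x \<ge> 1" "\<bar>Arg x\<bar> < pi / 4"
  defines "C \<equiv> 60 * B ^ 6 * exp ((4 * B + 10)\<^sup>2 / 4) * exp (B\<^sup>2 / 4)"
  shows "Gauss_integrable x (\<lambda>r. cosh_weight z r * cos (2 * w * csqrt x * of_real (sqrt (1 + r\<^sup>2) - 1)))"
    and "Gauss_integrable x (\<lambda>r. cosh_weight z r * sin (2 * w * csqrt x * of_real (sqrt (1 + r\<^sup>2) - 1)))"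
    and "Gauss_integrable x (\<lambda>r. cosh_weight z r * cos (2 * w * csqrt x * of_real r))"
    and "norm (P_coeff x z w - (1 + (32 * z ^ 2 - 3 * w ^ 2 - 8) / (128 * x))) \<le> C * norm x powr (- 2)"
    and "norm (Q_coeff x z w - w / (8 * csqrt x)) \<le> C * norm x powr (- (3 / 2))"
    and "norm (R_coeff x z w - (1 + (4 * z ^ 2 - 1) * (2 - w ^ 2) / (32 * x))) \<le> C * norm x powr (- 2)"
proof -
  have x0: "x \<noteq> 0" using x by auto
  have Re: "Re x > 0" using Re_pos_of_Arg[OF x0] x by simp
  define D where "D = 4 * B + 10"
  define \<alpha> where "\<alpha> = 2 * z\<^sup>2 - 1/2"
  have p2: "norm x powr (- 2) = 1 / norm x ^ 2"
    using x0 by (simp add: powr_minus divide_inverse)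
  have p3: "norm x powr (- (3 / 2)) = 1 / sqrt (norm x) ^ 3"
  proof -
    have "sqrt (norm x) ^ 3 = (norm x powr (1/2)) powr 3"
      using x0 by (simp add: powr_half_sqrt)
    also have "\<dots> = norm x powr (3 / 2)" by (simp add: powr_powr)
    finally have e: "sqrt (norm x) ^ 3 = norm x powr (3 / 2)" .
    show ?thesis unfolding e powr_minus by (rule inverse_eq_divide)
  qed
  note G = Gauss_mean_values[OF Re]
  define K where "K = B ^ 6 * exp (D\<^sup>2 / 4)"
  have K0: "K \<ge> 0" using B by (simp add: K_def)
  have KC: "60 * K \<le> C"
  proof -
    have "60 * K * 1 \<le> 60 * K * exp (B\<^sup>2 / 4)" using K0 by (intro mult_left_mono) auto
    then show ?thesis by (simp add: C_def K_def D_def)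
  qed

  define p where "p r = 1 + \<alpha> * of_real r ^ 2 - w\<^sup>2 * x / 2 * of_real r ^ 4" for r :: real
  have ip: "Gauss_integrable x p"
  proof -
    have "Gauss_integrable x (\<lambda>r. (1 + \<alpha> * of_real r ^ 2) + (- (w\<^sup>2 * x / 2)) * of_real r ^ 4)"
      by (intro Gauss_mean_add Gauss_mean_cmult G)
    then show ?thesis by (simp add: p_def[abs_def])
  qed
  have mp: "Gauss_mean x p = 1 + (32 * z ^ 2 - 3 * w ^ 2 - 8) / (128 * x)"
  proof -
    have "Gauss_mean x p = Gauss_mean x (\<lambda>r. 1) + \<alpha> * Gauss_mean x (\<lambda>r. of_real r ^ 2)
        - w\<^sup>2 * x / 2 * Gauss_mean x (\<lambda>r. of_real r ^ 4)"
      unfolding p_def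
      by (simp only: Gauss_mean_diff Gauss_mean_add Gauss_mean_cmult G)
    also have "\<dots> = 1 + (32 * z ^ 2 - 3 * w ^ 2 - 8) / (128 * x)"
      unfolding G \<alpha>_def using x0 by (simp add: field_simps power2_eq_square)
    finally show ?thesis .
  qed
  \<comment> \<open>Besides two continuity goals, these rules leave the pointwise comparison of integrand and model.\<close>
  note P = Gauss_mean_approx[OF x _ _ ip, of "\<lambda>r. cosh_weight z r * cos (2 * w * csqrt x * of_real (sqrt (1 + r\<^sup>2) - 1))"
        "30 * B ^ 6 / norm x ^ 2" D]
  have P1: "Gauss_integrable x (\<lambda>r. cosh_weight z r * cos (2 * w * csqrt x * of_real (sqrt (1 + r\<^sup>2) - 1)))"
    and P2: "norm (P_coeff x z w - (1 + (32 * z ^ 2 - 3 * w ^ 2 - 8) / (128 * x))) \<le> 2 * (30 * B ^ 6 / norm x ^ 2) * exp (D\<^sup>2 / 4)"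
    unfolding P_coeff_def mp[symmetric]
    by (rule P; (unfold p_def \<alpha>_def D_def)?; (rule P_integrand_expansion[OF B x(1)] | intro continuous_intros))+
  show "Gauss_integrable x (\<lambda>r. cosh_weight z r * cos (2 * w * csqrt x * of_real (sqrt (1 + r\<^sup>2) - 1)))"
    by (rule P1)
  have "2 * (30 * B ^ 6 / norm x ^ 2) * exp (D\<^sup>2 / 4) = 60 * K * (1 / norm x ^ 2)" by (simp add: K_def)
  also have "\<dots> \<le> C * (1 / norm x ^ 2)" by (intro mult_right_mono KC) auto
  finally show "norm (P_coeff x z w - (1 + (32 * z ^ 2 - 3 * w ^ 2 - 8) / (128 * x))) \<le> C * norm x powr (- 2)"
    using P2 unfolding p2 by linarith

  define q where "q r = w * csqrt x * of_real r ^ 2" for r :: real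
  have iq: "Gauss_integrable x q"
    unfolding q_def by (intro Gauss_mean_cmult G)
  have mq: "Gauss_mean x q = w / (8 * csqrt x)"
  proof -
    have "Gauss_mean x q = w * csqrt x * (1 / (8 * x))"
      unfolding q_def by (simp only: Gauss_mean_cmult G)
    also have "\<dots> = w * csqrt x * (1 / (8 * (csqrt x)\<^sup>2))" by simp
    also have "\<dots> = w / (8 * csqrt x)" by (simp add: power2_eq_square del: power2_csqrt)
    finally show ?thesis .
  qed
  note Q = Gauss_mean_approx[OF x _ _ iq, of "\<lambda>r. cosh_weight z r * sin (2 * w * csqrt x * of_real (sqrt (1 + r\<^sup>2) - 1))"
        "7 * B ^ 6 / sqrt (norm x) ^ 3" D]
  have Q1: "Gauss_integrable x (\<lambda>r. cosh_weight z r * sin (2 * w * csqrt x * of_real (sqrt (1 + r\<^sup>2) - 1)))"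
    and Q2: "norm (Q_coeff x z w - w / (8 * csqrt x)) \<le> 2 * (7 * B ^ 6 / sqrt (norm x) ^ 3) * exp (D\<^sup>2 / 4)"
    unfolding Q_coeff_def mq[symmetric]
    by (rule Q; (unfold q_def D_def)?; (rule Q_integrand_expansion[OF B x(1)] | intro continuous_intros))+
  show "Gauss_integrable x (\<lambda>r. cosh_weight z r * sin (2 * w * csqrt x * of_real (sqrt (1 + r\<^sup>2) - 1)))"
    by (rule Q1)
  have "2 * (7 * B ^ 6 / sqrt (norm x) ^ 3) * exp (D\<^sup>2 / 4) = 14 * K * (1 / sqrt (norm x) ^ 3)" by (simp add: K_def)
  also have "\<dots> \<le> C * (1 / sqrt (norm x) ^ 3)" using KC K0 by (intro mult_right_mono) auto
  finally show "norm (Q_coeff x z w - w / (8 * csqrt x)) \<le> C * norm x powr (- (3 / 2))"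
    using Q2 unfolding p3 by linarith

  define s where "s r = (1 + \<alpha> * of_real r ^ 2) * cos (2 * w * csqrt x * of_real r)" for r :: real
  have s: "s = (\<lambda>r. cos (2 * w * csqrt x * of_real r) + \<alpha> * (of_real r ^ 2 * cos (2 * w * csqrt x * of_real r)))"
    by (simp add: s_def fun_eq_iff distrib_right mult.assoc)
  have isum: "Gauss_integrable x s"
    unfolding s by (intro Gauss_mean_add Gauss_mean_cmult G)
  have ms: "exp (w\<^sup>2 / 4) * Gauss_mean x s = 1 + (4 * z ^ 2 - 1) * (2 - w ^ 2) / (32 * x)"
  proof -
    have "Gauss_mean x s = exp (- (w\<^sup>2) / 4) + \<alpha> * ((2 - w\<^sup>2) / (16 * x) * exp (- (w\<^sup>2) / 4))"
      unfolding s by (simp only: Gauss_mean_add Gauss_mean_cmult G)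
    also have "\<dots> = exp (- (w\<^sup>2) / 4) * (1 + (4 * z ^ 2 - 1) * (2 - w ^ 2) / (32 * x))"
      unfolding \<alpha>_def using x0 by (simp add: field_simps)
    finally have "exp (w\<^sup>2 / 4) * Gauss_mean x s =
      (exp (w\<^sup>2 / 4) * exp (- (w\<^sup>2) / 4)) * (1 + (4 * z ^ 2 - 1) * (2 - w ^ 2) / (32 * x))"
      by (simp only: mult.assoc)
    also have "exp (w\<^sup>2 / 4) * exp (- (w\<^sup>2) / 4) = 1" by (simp flip: exp_add)
    finally show ?thesis by simp
  qed
  note R = Gauss_mean_approx[OF x _ _ isum, of "\<lambda>r. cosh_weight z r * cos (2 * w * csqrt x * of_real r)"
        "20 * B ^ 6 / norm x ^ 2" D]
  have R1: "Gauss_integrable x (\<lambda>r. cosh_weight z r * cos (2 * w * csqrt x * of_real r))"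
    and R2: "norm (Gauss_mean x (\<lambda>r. cosh_weight z r * cos (2 * w * csqrt x * of_real r)) - Gauss_mean x s)
       \<le> 2 * (20 * B ^ 6 / norm x ^ 2) * exp (D\<^sup>2 / 4)"
    by (rule R; (unfold s_def \<alpha>_def D_def)?; (rule R_integrand_expansion[OF B x(1)] | intro continuous_intros))+
  show "Gauss_integrable x (\<lambda>r. cosh_weight z r * cos (2 * w * csqrt x * of_real r))"
    by (rule R1)
  have "R_coeff x z w - (1 + (4 * z ^ 2 - 1) * (2 - w ^ 2) / (32 * x)) =
     exp (w\<^sup>2 / 4) * (Gauss_mean x (\<lambda>r. cosh_weight z r * cos (2 * w * csqrt x * of_real r)) - Gauss_mean x s)"
    unfolding R_coeff_def ms[symmetric] by (simp only: right_diff_distrib)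
  also have "norm \<dots> \<le> exp (B\<^sup>2 / 4) * (2 * (20 * B ^ 6 / norm x ^ 2) * exp (D\<^sup>2 / 4))"
    unfolding norm_mult
  proof (rule mult_mono[OF _ R2])
    have "Re (w\<^sup>2 / 4) \<le> norm (w\<^sup>2 / 4)" by (rule complex_Re_le_cmod)
    also have "\<dots> \<le> B\<^sup>2 / 4" using power_mono[OF B(3) norm_ge_zero, of 2] by (simp add: norm_divide norm_power)
    finally show "norm (exp (w\<^sup>2 / 4)) \<le> exp (B\<^sup>2 / 4)" by simp
  qed auto
  also have "\<dots> = (40 * K * exp (B\<^sup>2 / 4)) * (1 / norm x ^ 2)" by (simp add: K_def)
  also have "\<dots> \<le> C * (1 / norm x ^ 2)"
    using K0 by (intro mult_right_mono) (auto simp: C_def K_def D_def)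
  finally show "norm (R_coeff x z w - (1 + (4 * z ^ 2 - 1) * (2 - w ^ 2) / (32 * x))) \<le> C * norm x powr (- 2)"
    unfolding p2 .
qed

lemma csqrt_divide_of_Re_pos:
  fixes x :: complex
  assumes "Re x > 0" "a > 0"
  shows "csqrt (of_real a / x) = of_real (sqrt a) / csqrt x"
proof (rule csqrt_unique)
  have x0: "x \<noteq> 0" using assms by auto
  show "(of_real (sqrt a) / csqrt x)\<^sup>2 = of_real a / x"
    using assms by (simp add: power_divide flip: of_real_power)
  have "Re s \<noteq> 0" if "Re (s\<^sup>2) > 0" for s :: complex
    using that by (auto simp: power2_eq_square)
  from this[of "csqrt x"] have "Re (csqrt x) > 0"
    using assms csqrt_principal[of x] by auto
  moreover have "Re (of_real t / s) > 0" if "Re s > 0" "t > 0" for s :: complex and t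
  proof -
    have "s \<noteq> 0" using that by auto
    then show ?thesis using that by (simp add: Re_divide sum_power2_gt_zero_iff complex_eq_iff)
  qed
  ultimately have "Re (of_real (sqrt a) / csqrt x) > 0"
    using assms by (metis real_sqrt_gt_zero)
  then show "0 < Re (of_real (sqrt a) / csqrt x) \<or>
     Re (of_real (sqrt a) / csqrt x) = 0 \<and> 0 \<le> Im (of_real (sqrt a) / csqrt x)" ..
qed

text \<open>
The addition theorem for \<open>cos (u (1 + \<delta>))\<close> splits the Laplace integral into the three Gaussian means.
\<close>

lemma gen_bessel_K_eq_coeffs:
  fixes x z w :: complex and c :: real
  assumes x: "norm x \<ge> 1" "\<bar>Arg x\<bar> < pi / 4" and c: "c > \<bar>Re z\<bar>"
  shows "gen_bessel_K c z w (2 * x) =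
                 1 / 4 * csqrt (of_real pi / x) * exp (- 2 * x)
                 * (cos (2 * w * csqrt x) * P_coeff x z w - sin (2 * w * csqrt x) * Q_coeff x z w
                    + exp (- (w ^ 2) / 4) * R_coeff x z w)"
proof -
  have x0: "x \<noteq> 0" using x by auto
  have Re: "Re x > 0" using Re_pos_of_Arg[OF x0] x by simp
  define u where "u = 2 * w * csqrt x"
  define B where "B = max 1 (max (norm z) (norm w))"
  have B: "B \<ge> 1" "norm z \<le> B" "norm w \<le> B" by (auto simp: B_def)
  note i = coeff_expansions(1-3)[OF B x, folded u_def]
  define f where "f r = cosh_weight z r * cos (u * of_real (sqrt (1 + r\<^sup>2) - 1))" for r
  define g where "g r = cosh_weight z r * sin (u * of_real (sqrt (1 + r\<^sup>2) - 1))" for r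
  define k where "k r = cosh_weight z r * cos (u * of_real r)" for r
  note i' = i[folded f_def g_def k_def]
  have split: "cosh_weight z r * (cos (u * of_real (sqrt (1 + r\<^sup>2))) + cos (u * of_real r)) =
     (cos u * f r - sin u * g r) + k r" for r
  proof -
    have "u * of_real (sqrt (1 + r\<^sup>2)) = u + u * of_real (sqrt (1 + r\<^sup>2) - 1)"
      by (simp add: algebra_simps)
    then have "cos (u * of_real (sqrt (1 + r\<^sup>2))) = cos u * cos (u * of_real (sqrt (1 + r\<^sup>2) - 1))
        - sin u * sin (u * of_real (sqrt (1 + r\<^sup>2) - 1))"
      by (simp only: cos_add)
    moreover have "h * ((p * a - q * b) + d) = (p * (h * a) - q * (h * b)) + h * d" for h p q a b d :: complex
      by (simp add: algebra_simps)
    ultimately show ?thesis unfolding f_def g_def k_def by (simp only:)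
  qed
  have "gen_bessel_K c z w (2 * x) = (\<integral>r. exp (- 2 * x) / 2 * (exp (- (4 * x) * of_real r ^ 2) * cosh_weight z r *
        (cos (u * of_real (sqrt (1 + r\<^sup>2))) + cos (u * of_real r))) \<partial>lborel)"
    using has_bochner_integral_integral_eq[OF gen_bessel_K_eq_Laplace_integral[OF x0 x(2) c]]
    unfolding u_def by simp
  also have "\<dots> = exp (- 2 * x) / 2 * (\<integral>r. exp (- (4 * x) * of_real r ^ 2) * ((cos u * f r - sin u * g r) + k r) \<partial>lborel)"
    unfolding mult.assoc[of _ "cosh_weight z _"] split integral_mult_right_zero ..
  also have "(\<integral>r. exp (- (4 * x) * of_real r ^ 2) * ((cos u * f r - sin u * g r) + k r) \<partial>lborel) =
      of_real (sqrt pi) / (2 * csqrt x) * Gauss_mean x (\<lambda>r. (cos u * f r + (- sin u) * g r) + k r)"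
    using x0 by (simp add: Gauss_mean_def)
  also have "Gauss_mean x (\<lambda>r. (cos u * f r + (- sin u) * g r) + k r) = cos u * P_coeff x z w - sin u * Q_coeff x z w + exp (- (w ^ 2) / 4) * R_coeff x z w"
  proof -
    have "exp (- (w ^ 2) / 4) * R_coeff x z w = (exp (- (w ^ 2) / 4) * exp (w ^ 2 / 4)) * Gauss_mean x k"
      unfolding R_coeff_def k_def u_def by (simp only: mult.assoc)
    also have "exp (- (w ^ 2) / 4) * exp (w ^ 2 / 4) = 1" by (simp flip: exp_add)
    finally have R: "exp (- (w ^ 2) / 4) * R_coeff x z w = Gauss_mean x k" by simp
    have "Gauss_mean x f = P_coeff x z w" "Gauss_mean x g = Q_coeff x z w"
      unfolding P_coeff_def Q_coeff_def f_def g_def u_def by simp_all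
    then show ?thesis unfolding R
      by (simp only: Gauss_mean_add Gauss_mean_cmult i') simp
  qed
  finally show ?thesis
    unfolding csqrt_divide_of_Re_pos[OF Re pi_gt_zero] u_def by simp
qed

theorem theorem1p12:
  "\<exists>P Q R :: complex \<Rightarrow> complex \<Rightarrow> complex \<Rightarrow> complex.
     \<forall>Z W :: complex set. compact Z \<longrightarrow> compact W \<longrightarrow>
       (\<exists>(X::real) > 0. \<exists>C::real. \<forall>z\<in>Z. \<forall>w\<in>W. \<forall>x::complex.
          norm x \<ge> X \<longrightarrow> \<bar>Arg x\<bar> < pi / 4 \<longrightarrow>
            (\<forall>c::real. c > \<bar>Re z\<bar> \<longrightarrow>
               gen_bessel_K c z w (2 * x) =
                 1 / 4 * csqrt (of_real pi / x) * exp (- 2 * x)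
                 * (cos (2 * w * csqrt x) * P x z w - sin (2 * w * csqrt x) * Q x z w
                    + exp (- (w ^ 2) / 4) * R x z w))
          \<and> norm (P x z w - (1 + (32 * z ^ 2 - 3 * w ^ 2 - 8) / (128 * x)))
               \<le> C * norm x powr (- 2)
          \<and> norm (Q x z w - w / (8 * csqrt x)) \<le> C * norm x powr (- (3 / 2))
          \<and> norm (R x z w - (1 + (4 * z ^ 2 - 1) * (2 - w ^ 2) / (32 * x)))
               \<le> C * norm x powr (- 2))"
proof (rule exI[of _ P_coeff], rule exI[of _ Q_coeff], rule exI[of _ R_coeff], intro allI impI)
  fix Z W :: "complex set"
  assume "compact Z" "compact W"
  then have "bounded (Z \<union> W)" by (simp add: compact_imp_bounded)
  then obtain B0 where B0: "\<And>u. u \<in> Z \<union> W \<Longrightarrow> norm u \<le> B0" by (auto simp: bounded_iff)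
  define B where "B = max 1 B0"
  have B: "B \<ge> 1" "norm z \<le> B" "norm w \<le> B" if "z \<in> Z" "w \<in> W" for z w
    using B0[of z] B0[of w] that by (auto simp: B_def)
  show "\<exists>(X::real) > 0. \<exists>C::real. \<forall>z\<in>Z. \<forall>w\<in>W. \<forall>x::complex.
          norm x \<ge> X \<longrightarrow> \<bar>Arg x\<bar> < pi / 4 \<longrightarrow>
            (\<forall>c::real. c > \<bar>Re z\<bar> \<longrightarrow>
               gen_bessel_K c z w (2 * x) =
                 1 / 4 * csqrt (of_real pi / x) * exp (- 2 * x)
                 * (cos (2 * w * csqrt x) * P_coeff x z w - sin (2 * w * csqrt x) * Q_coeff x z w
                    + exp (- (w ^ 2) / 4) * R_coeff x z w))
          \<and> norm (P_coeff x z w - (1 + (32 * z ^ 2 - 3 * w ^ 2 - 8) / (128 * x)))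
               \<le> C * norm x powr (- 2)
          \<and> norm (Q_coeff x z w - w / (8 * csqrt x)) \<le> C * norm x powr (- (3 / 2))
          \<and> norm (R_coeff x z w - (1 + (4 * z ^ 2 - 1) * (2 - w ^ 2) / (32 * x)))
               \<le> C * norm x powr (- 2)"
    by (intro exI[of _ "1::real"] exI[of _ "60 * B ^ 6 * exp ((4 * B + 10)\<^sup>2 / 4) * exp (B\<^sup>2 / 4)"]
          conjI ballI allI impI zero_less_one gen_bessel_K_eq_coeffs coeff_expansions B)
qed

end
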